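(* Let $(B(t)\colon t\ge 0)$ be a one-dimensional standard Brownian motion started at the origin, let $(L(x,t)\colon x\in\mathbb{R},\,t\ge 0)$ be its local time field, and let $\sigma:=\inf\{t\ge 0\colon |B(t)|=1\}$. Then, for every real $q\ge 1$, $$-\log \mathbb{P}\Big\{ \int_{-\infty}^\infty L^{q}(x,\sigma)\, dx < \varepsilon \Big\} \asymp \varepsilon^{-\frac{1}{q}}.$$
   Context: $a(\varepsilon)\asymp b(\varepsilon)$ means that there exist constants $0<c<C<\infty$ (not depending on $\varepsilon$) such that $c\,a(\varepsilon)\le b(\varepsilon)\le C\,a(\varepsilon)$ for all $0<\varepsilon<1$. The local time $L(x,t)$ is the jointly continuous density, with respect to Lebesgue measure in $x$, of the occupation measure of $B$ up to time $t$. $L^{q}(x,t)$ denotes $(L(x,t))^{q}$. *)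

theory Defs
  imports "HOL-Probability.Probability"
begin

(* The initial value and path continuity are required only almost surely. *)
locale standard_brownian_motion = prob_space M
  for M :: "'a measure" and B :: "real \<Rightarrow> 'a \<Rightarrow> real" +
  assumes measurable_B: "\<And>t. 0 \<le> t \<Longrightarrow> random_variable borel (B t)"
    and start_origin: "AE \<omega> in M. B 0 \<omega> = 0"
    and indep_increments:
      "\<And>(n::nat) (t::nat \<Rightarrow> real). 0 \<le> t 0 \<Longrightarrow> (\<And>i. i < n \<Longrightarrow> t i \<le> t (Suc i)) \<Longrightarrow>
         indep_vars (\<lambda>_. borel) (\<lambda>i \<omega>. B (t (Suc i)) \<omega> - B (t i) \<omega>) {..<n}"
    and normal_increments:
      "\<And>s t. 0 \<le> s \<Longrightarrow> s < t \<Longrightarrow>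
         distributed M lborel (\<lambda>\<omega>. B t \<omega> - B s \<omega>) (\<lambda>x. ennreal (normal_density 0 (sqrt (t - s)) x))"
    and continuous_paths: "AE \<omega> in M. continuous_on {0..} (\<lambda>t. B t \<omega>)"

definition occupation_measure :: "(real \<Rightarrow> 'a \<Rightarrow> real) \<Rightarrow> real \<Rightarrow> 'a \<Rightarrow> real measure" where
  "occupation_measure B t \<omega> = distr (restrict_space lborel {0..t}) lborel (\<lambda>s. B s \<omega>)"

(* Nonnegativity is stated separately because ennreal truncates negative values to 0. *)
definition local_time_field ::
  "'a measure \<Rightarrow> (real \<Rightarrow> 'a \<Rightarrow> real) \<Rightarrow> (real \<Rightarrow> real \<Rightarrow> 'a \<Rightarrow> real) \<Rightarrow> bool" where
  "local_time_field M B L \<longleftrightarrow>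
     (AE \<omega> in M.
        continuous_on (UNIV \<times> {0..}) (\<lambda>(x, t). L x t \<omega>) \<and>
        (\<forall>x. \<forall>t\<ge>0. 0 \<le> L x t \<omega>) \<and>
        (\<forall>t\<ge>0. occupation_measure B t \<omega> = density lborel (\<lambda>x. ennreal (L x t \<omega>))))"

(* The set is nonempty almost surely; on the exceptional null set the value is irrelevant. *)
definition exit_time :: "(real \<Rightarrow> 'a \<Rightarrow> real) \<Rightarrow> 'a \<Rightarrow> real" where
  "exit_time B \<omega> = Inf {t. 0 \<le> t \<and> \<bar>B t \<omega>\<bar> = 1}"

definition comparable_on_unit :: "(real \<Rightarrow> real) \<Rightarrow> (real \<Rightarrow> real) \<Rightarrow> bool" where
  "comparable_on_unit a b \<longleftrightarrow>
     (\<exists>c C. 0 < c \<and> c < C \<and>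
        (\<forall>\<epsilon>. 0 < \<epsilon> \<and> \<epsilon> < 1 \<longrightarrow> c * a \<epsilon> \<le> b \<epsilon> \<and> b \<epsilon> \<le> C * a \<epsilon>))"

(* Since path properties hold only almost surely, the event is in general measurable only
   with respect to the completion of M. *)
definition small_local_time_prob ::
  "'a measure \<Rightarrow> (real \<Rightarrow> 'a \<Rightarrow> real) \<Rightarrow> (real \<Rightarrow> real \<Rightarrow> 'a \<Rightarrow> real) \<Rightarrow> real \<Rightarrow> real \<Rightarrow> real" where
  "small_local_time_prob M B L q \<epsilon> =
     measure (completion M)
       {\<omega> \<in> space M. (\<integral>\<^sup>+ x. ennreal (L x (exit_time B \<omega>) \<omega> powr q) \<partial>lborel) < ennreal \<epsilon>}"

(* In comparable_on_unit (\<lambda>\<epsilon>. - ln (p \<epsilon>)) b with b > 0, the convention ln 0 = 0 is harmless: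
   the upper bound b \<epsilon> \<le> C * - ln (p \<epsilon>) already forces p \<epsilon> to be nonzero. *)

end

theory Submission
  imports Defs
begin

text \<open>Write \<open>\<delta> = \<epsilon> powr (1/q)\<close>; both directions compare the event with an event of probability
\<open>exp (- const / \<delta>)\<close>.

Upper bound. Up to the exit time the path stays in \<open>[-1, 1]\<close>, so the local time at the exit time is
supported there and has total mass equal to the exit time. By convexity of the \<open>q\<close>-th power a small
power integral forces a small total mass: the exit time is below \<open>2 \<delta>\<close>
(\<open>exit_less_of_small_power_integral\<close>). Levy's maximal inequality on a time grid and the Gaussian tail
bound the probability of this by \<open>exp (- const / \<delta>)\<close>. The constants matter only as \<open>\<epsilon>\<close> approaches 1, where
the bound has to stay strictly below 1; there it is used that twice the
Gaussian tail beyond 0.7 standard deviations is still below 1.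

Lower bound. Let the path move with drift \<open>\<mu>\<close> of order \<open>1 / \<delta>\<close> during the time \<open>T = 2 / \<mu>\<close>. The law of
Brownian motion with drift has the density \<open>Z = exp (\<mu> B_T - \<mu>\<^sup>2 T / 2)\<close> (Cameron and Martin), and
\<open>Z \<le> exp (2 \<mu>)\<close> where \<open>B_T \<le> 3\<close>. Under the drift, \<open>B_T\<close> is within 1 of its mean 2 with high
probability, so the exit happens before \<open>T\<close>. It remains to see that a power integral of the local time
at \<open>T\<close> is of order \<open>\<mu> powr (-q)\<close>. For an integer exponent \<open>m\<close> its mean is computed by summing over \<open>m\<close>
successive visits to a point: each return after the first visit contributes a factor \<open>1 / \<mu>\<close>, the
expected time density that drifted Brownian motion spends near its current position, and the first
visit contributes \<open>T\<close> after integration over the point. Real exponents follow by interpolating between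
1 and an integer \<open>m \<ge> q\<close>. By Markov's inequality the event has at least a fixed probability under the
drift, hence probability at least \<open>exp (- 4 \<mu>)\<close> without it (\<open>drifted_paths_prob\<close>).

The moment computation is carried out for random walks sampled from the path (\<open>drift_occupation_moment\<close>),
where the Markov property is just independence of finitely many increments. Fatou's lemma, first in
the mesh of the time grid and then in the width of the spatial window, transfers it to the local time.\<close>

section \<open>Gaussian estimates\<close>

text \<open>The elementary form of the Cameron-Martin change of measure: the weight completes the square.\<close>

lemma normal_density_tilt:
  fixes s :: real
  assumes "0 < s"
  shows "normal_density 0 (sqrt s) x * exp (\<mu> * x - \<mu>\<^sup>2 * s / 2) = normal_density (\<mu> * s) (sqrt s) x"
proof -
  have "- (x\<^sup>2) / (2 * s) + (\<mu> * x - \<mu>\<^sup>2 * s / 2) = - (x - \<mu> * s)\<^sup>2 / (2 * s)"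
    using assms by (simp add: field_simps power2_eq_square)
  then show ?thesis
    using assms by (simp add: normal_density_def mult_exp_exp)
qed

lemma normal_density_le_peak:
  fixes s :: real
  assumes "0 < s"
  shows "normal_density m (sqrt s) x \<le> 1 / sqrt (2 * pi * s)"
  using assms by (auto simp: normal_density_def divide_simps)

lemma emeasure_Collect_eq_nn_integral:
  assumes [measurable]: "D \<in> borel_measurable M" "S \<in> sets borel"
  shows "emeasure M {\<omega> \<in> space M. D \<omega> \<in> S} = (\<integral>\<^sup>+\<omega>. indicator S (D \<omega>) \<partial>M)"
proof -
  have "emeasure M {\<omega> \<in> space M. D \<omega> \<in> S} = (\<integral>\<^sup>+\<omega>. indicator {\<omega> \<in> space M. D \<omega> \<in> S} \<omega> \<partial>M)"
    by (rule nn_integral_indicator[symmetric]) measurable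
  also have "\<dots> = (\<integral>\<^sup>+\<omega>. indicator S (D \<omega>) \<partial>M)"
    by (intro nn_integral_cong) (auto simp: indicator_def)
  finally show ?thesis .
qed

context prob_space
begin

lemma nn_integral_tilted_gaussian:
  assumes D: "distributed M lborel D (normal_density 0 (sqrt s))" and "0 < s"
    and g: "g \<in> borel_measurable borel"
  shows "(\<integral>\<^sup>+\<omega>. ennreal (exp (\<mu> * D \<omega> - \<mu>\<^sup>2 * s / 2)) * g (D \<omega>) \<partial>M)
       = (\<integral>\<^sup>+x. ennreal (normal_density (\<mu> * s) (sqrt s) x) * g x \<partial>lborel)"
proof -
  have g': "(\<lambda>x. ennreal (exp (\<mu> * x - \<mu>\<^sup>2 * s / 2)) * g x) \<in> borel_measurable lborel"
    using g by measurable
  show ?thesis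
    unfolding distributed_nn_integral[OF D g', symmetric] mult.assoc[symmetric]
    by (simp flip: ennreal_mult' add: normal_density_tilt[OF \<open>0 < s\<close>])
qed

lemma tilted_gaussian_mean:
  assumes D: "distributed M lborel D (normal_density 0 (sqrt s))" and "0 < s"
  shows "(\<integral>\<^sup>+\<omega>. ennreal (exp (\<mu> * D \<omega> - \<mu>\<^sup>2 * s / 2)) \<partial>M) = 1"
  using nn_integral_tilted_gaussian[OF assms, of "\<lambda>_. 1" \<mu>] \<open>0 < s\<close>
  by (simp add: nn_integral_eq_integral)

text \<open>The exponential factor in \<open>\<mu>\<^sup>2 s\<close> is what makes the expected number of returns of a walk with
drift finite uniformly in the time horizon.\<close>

lemma tilted_gaussian_small:
  assumes D: "distributed M lborel D (normal_density 0 (sqrt s))" and "0 < s" "0 \<le> \<mu>" "0 \<le> r"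
  shows "(\<integral>\<^sup>+\<omega>. ennreal (exp (\<mu> * D \<omega> - \<mu>\<^sup>2 * s / 2)) * indicator {x. \<bar>x\<bar> < r} (D \<omega>) \<partial>M)
       \<le> ennreal (2 * r * exp (\<mu> * r) * exp (- (\<mu>\<^sup>2 * s / 2)) / sqrt (2 * pi * s))"
proof -
  let ?c = "exp (\<mu> * r) * exp (- (\<mu>\<^sup>2 * s / 2)) / sqrt (2 * pi * s)"
  have *: "ennreal (normal_density (\<mu> * s) (sqrt s) x) * indicator {x. \<bar>x\<bar> < r} x
      \<le> ennreal ?c * indicator {-r<..<r} x" for x
  proof (cases "\<bar>x\<bar> < r")
    case True
    then have "\<mu> * x \<le> \<mu> * r" using \<open>0 \<le> \<mu>\<close> by (intro mult_left_mono) auto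
    then have "exp (\<mu> * x - \<mu>\<^sup>2 * s / 2) \<le> exp (\<mu> * r) * exp (- (\<mu>\<^sup>2 * s / 2))"
      by (simp add: mult_exp_exp)
    then have "normal_density (\<mu> * s) (sqrt s) x \<le> 1 / sqrt (2 * pi * s) * (exp (\<mu> * r) * exp (- (\<mu>\<^sup>2 * s / 2)))"
      unfolding normal_density_tilt[OF \<open>0 < s\<close>, symmetric]
      by (intro mult_mono normal_density_le_peak) (use \<open>0 < s\<close> in auto)
    with True show ?thesis by (auto simp: indicator_def ennreal_leI)
  qed auto
  have "(\<integral>\<^sup>+\<omega>. ennreal (exp (\<mu> * D \<omega> - \<mu>\<^sup>2 * s / 2)) * indicator {x. \<bar>x\<bar> < r} (D \<omega>) \<partial>M)
     = (\<integral>\<^sup>+x. ennreal (normal_density (\<mu> * s) (sqrt s) x) * indicator {x. \<bar>x\<bar> < r} x \<partial>lborel)"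
    by (rule nn_integral_tilted_gaussian[OF D \<open>0 < s\<close>]) measurable
  also have "\<dots> \<le> (\<integral>\<^sup>+x. ennreal ?c * indicator {-r<..<r} x \<partial>lborel)"
    by (intro nn_integral_mono *)
  also have "\<dots> = ennreal (?c * (2 * r))"
    using \<open>0 \<le> r\<close> \<open>0 < s\<close> by (simp add: nn_integral_cmult_indicator ennreal_mult' [symmetric])
  finally show ?thesis by (simp add: mult_ac)
qed

lemma tilted_gaussian_deviation:
  assumes D: "distributed M lborel D (normal_density 0 (sqrt s))" and "0 < s"
  shows "(\<integral>\<^sup>+\<omega>. ennreal (exp (\<mu> * D \<omega> - \<mu>\<^sup>2 * s / 2)) * indicator {x. 1 \<le> \<bar>x - \<mu> * s\<bar>} (D \<omega>) \<partial>M)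
       \<le> ennreal s"
proof -
  have "(\<integral>\<^sup>+\<omega>. ennreal (exp (\<mu> * D \<omega> - \<mu>\<^sup>2 * s / 2)) * indicator {x. 1 \<le> \<bar>x - \<mu> * s\<bar>} (D \<omega>) \<partial>M)
     = (\<integral>\<^sup>+x. ennreal (normal_density (\<mu> * s) (sqrt s) x) * indicator {x. 1 \<le> \<bar>x - \<mu> * s\<bar>} x \<partial>lborel)"
    by (rule nn_integral_tilted_gaussian[OF D \<open>0 < s\<close>]) measurable
  also have "\<dots> \<le> (\<integral>\<^sup>+x. ennreal (normal_density (\<mu> * s) (sqrt s) x * (x - \<mu> * s)^(2*1)) \<partial>lborel)"
  proof (intro nn_integral_mono)
    fix x
    have "1 \<le> (x - \<mu> * s)\<^sup>2" if "1 \<le> \<bar>x - \<mu> * s\<bar>"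
      using that abs_le_square_iff[of 1 "x - \<mu> * s"] by simp
    then show "ennreal (normal_density (\<mu> * s) (sqrt s) x) * indicator {x. 1 \<le> \<bar>x - \<mu> * s\<bar>} x
       \<le> ennreal (normal_density (\<mu> * s) (sqrt s) x * (x - \<mu> * s)^(2*1))"
      using mult_left_mono[of 1 "(x - \<mu> * s)\<^sup>2" "normal_density (\<mu> * s) (sqrt s) x"]
      by (auto simp: indicator_def intro!: ennreal_leI)
  qed
  also have "\<dots> = ennreal s"
    using normal_moment_even[of "sqrt s" "\<mu> * s" 1] \<open>0 < s\<close>
    by (subst nn_integral_eq_integral) (auto simp: has_bochner_integral_iff)
  finally show ?thesis .
qed

lemma gaussian_small_prob:
  assumes D: "distributed M lborel D (normal_density 0 (sqrt s))" and "0 < s" "0 \<le> r"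
  shows "prob {\<omega> \<in> space M. \<bar>D \<omega>\<bar> < r} \<le> 2 * r / sqrt (2 * pi * s)"
proof -
  have [measurable]: "D \<in> borel_measurable M" using distributed_measurable[OF D] by simp
  have "emeasure M {\<omega> \<in> space M. \<bar>D \<omega>\<bar> < r} = (\<integral>\<^sup>+\<omega>. indicator {x. \<bar>x\<bar> < r} (D \<omega>) \<partial>M)"
    using emeasure_Collect_eq_nn_integral[of D M "{x. \<bar>x\<bar> < r}"] by simp
  also have "\<dots> \<le> ennreal (2 * r / sqrt (2 * pi * s))"
    using tilted_gaussian_small[OF D \<open>0 < s\<close>, of 0 r] \<open>0 \<le> r\<close> by simp
  finally show ?thesis
    using \<open>0 \<le> r\<close> \<open>0 < s\<close> by (simp add: emeasure_eq_measure)
qed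

text \<open>The symmetry input of Levy's maximal inequality.\<close>

lemma gaussian_half:
  assumes D: "distributed M lborel D (normal_density 0 (sqrt s))" and "0 < s"
  shows "1/2 \<le> prob {\<omega> \<in> space M. 0 \<le> D \<omega>}" "1/2 \<le> prob {\<omega> \<in> space M. D \<omega> \<le> 0}"
proof -
  have [measurable]: "D \<in> borel_measurable M" using distributed_measurable[OF D] by simp
  have D': "distributed M lborel (\<lambda>\<omega>. 0 + (-1) * D \<omega>) (normal_density (0 + (-1) * 0) (\<bar>-1\<bar> * sqrt s))"
    by (rule normal_density_affine[OF D]) (use \<open>0 < s\<close> in auto)
  have "emeasure M {\<omega> \<in> space M. D \<omega> \<le> 0} = emeasure M {\<omega> \<in> space M. 0 \<le> D \<omega>}"
    using distributed_emeasure[OF D, of "{0..}"] distributed_emeasure[OF D', of "{0..}"]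
    by (simp add: vimage_def Int_def conj_commute)
  then have eq: "prob {\<omega> \<in> space M. D \<omega> \<le> 0} = prob {\<omega> \<in> space M. 0 \<le> D \<omega>}"
    by (simp add: measure_def)
  have "1 = prob ({\<omega> \<in> space M. D \<omega> \<le> 0} \<union> {\<omega> \<in> space M. 0 \<le> D \<omega>})"
    by (subst prob_space[symmetric]) (rule arg_cong[where f=prob], auto)
  also have "\<dots> \<le> prob {\<omega> \<in> space M. D \<omega> \<le> 0} + prob {\<omega> \<in> space M. 0 \<le> D \<omega>}"
    by (rule measure_Un_le) measurable
  finally show "1/2 \<le> prob {\<omega> \<in> space M. 0 \<le> D \<omega>}" "1/2 \<le> prob {\<omega> \<in> space M. D \<omega> \<le> 0}"
    using eq by auto
qed

text \<open>Half of the exponent is kept as a bound; the other half turns the density into that of a Gaussian of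
doubled variance, which integrates to 1.\<close>

lemma gaussian_chernoff:
  assumes D: "distributed M lborel D (normal_density 0 (sqrt s))" and "0 < s" "0 \<le> a"
  shows "prob {\<omega> \<in> space M. a \<le> \<bar>D \<omega>\<bar>} \<le> sqrt 2 * exp (- (a\<^sup>2 / (4 * s)))"
proof -
  have [measurable]: "D \<in> borel_measurable M" using distributed_measurable[OF D] by simp
  have "emeasure M {\<omega> \<in> space M. a \<le> \<bar>D \<omega>\<bar>} = (\<integral>\<^sup>+\<omega>. indicator {x. a \<le> \<bar>x\<bar>} (D \<omega>) \<partial>M)"
    using emeasure_Collect_eq_nn_integral[of D M "{x. a \<le> \<bar>x\<bar>}"] by simp
  also have "\<dots> = (\<integral>\<^sup>+x. ennreal (normal_density 0 (sqrt s) x) * indicator {x. a \<le> \<bar>x\<bar>} x \<partial>lborel)"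
    by (rule distributed_nn_integral[OF D, symmetric]) measurable
  also have "\<dots> \<le> (\<integral>\<^sup>+x. ennreal (sqrt 2 * exp (- (a\<^sup>2 / (4 * s)))) * ennreal (normal_density 0 (sqrt (2 * s)) x) \<partial>lborel)"
  proof (intro nn_integral_mono)
    fix x
    have "normal_density 0 (sqrt s) x \<le> sqrt 2 * exp (- (a\<^sup>2 / (4 * s))) * normal_density 0 (sqrt (2 * s)) x"
      if "a \<le> \<bar>x\<bar>"
    proof -
      have "a\<^sup>2 \<le> x\<^sup>2" using that \<open>0 \<le> a\<close> by (metis abs_le_square_iff abs_of_nonneg)
      then have "- x\<^sup>2 / (2 * s) \<le> - (a\<^sup>2 / (4 * s)) + - x\<^sup>2 / (2 * (2 * s))"
        using \<open>0 < s\<close> by (simp add: field_simps)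
      then have "exp (- x\<^sup>2 / (2 * s)) \<le> exp (- (a\<^sup>2 / (4 * s))) * exp (- x\<^sup>2 / (2 * (2 * s)))"
        unfolding mult_exp_exp by simp
      then have "1 / sqrt (2 * pi * s) * exp (- x\<^sup>2 / (2 * s))
         \<le> 1 / sqrt (2 * pi * s) * (exp (- (a\<^sup>2 / (4 * s))) * exp (- x\<^sup>2 / (2 * (2 * s))))"
        using \<open>0 < s\<close> by (intro mult_left_mono) auto
      also have "\<dots> = sqrt 2 * exp (- (a\<^sup>2 / (4 * s))) * normal_density 0 (sqrt (2 * s)) x"
        using \<open>0 < s\<close> real_sqrt_mult[of 2 "2 * pi * s"] by (simp add: normal_density_def mult.left_commute mult.commute)
      finally show ?thesis using \<open>0 < s\<close> by (simp add: normal_density_def)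
    qed
    then show "ennreal (normal_density 0 (sqrt s) x) * indicator {x. a \<le> \<bar>x\<bar>} x
       \<le> ennreal (sqrt 2 * exp (- (a\<^sup>2 / (4 * s)))) * ennreal (normal_density 0 (sqrt (2 * s)) x)"
      by (auto simp: indicator_def ennreal_mult'[symmetric] intro!: ennreal_leI)
  qed
  also have "\<dots> = ennreal (sqrt 2 * exp (- (a\<^sup>2 / (4 * s))))"
    using \<open>0 < s\<close> by (simp add: nn_integral_cmult nn_integral_eq_integral)
  finally show ?thesis by (simp add: emeasure_eq_measure)
qed

text \<open>The density is bounded below through \<open>exp (-y) \<ge> 1 - y\<close>, which leaves a polynomial to integrate:
\<open>2 (0.7 - 0.343 / 6) / sqrt (2 \<pi>) > 0.51\<close>. Any value above one half would do.\<close>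

lemma gaussian_central_prob:
  assumes D: "distributed M lborel D (normal_density 0 (sqrt s))" and "0 < s"
  shows "51/100 \<le> prob {\<omega> \<in> space M. \<bar>D \<omega>\<bar> < 7/10 * sqrt s}"
proof -
  let ?r = "7/10 * sqrt s"
  let ?f = "\<lambda>x. 1 / sqrt (2 * pi * s) * (1 - x\<^sup>2 / (2 * s))"
  let ?F = "\<lambda>x. 1 / sqrt (2 * pi * s) * (x - x^3 / (6 * s))"
  have [measurable]: "D \<in> borel_measurable M" using distributed_measurable[OF D] by simp
  have fnn: "0 \<le> ?f x" if "-?r \<le> x" "x \<le> ?r" for x
  proof -
    have "\<bar>x\<bar> \<le> ?r" using that by auto
    then have "x\<^sup>2 \<le> ?r\<^sup>2" using power_mono[of "\<bar>x\<bar>" ?r 2] by auto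
    also have "\<dots> = 49/100 * s" using \<open>0 < s\<close> by (simp add: power_mult_distrib power2_eq_square)
    finally show ?thesis using \<open>0 < s\<close> by (auto simp: field_simps)
  qed
  have "(\<integral>\<^sup>+x. ennreal (?f x) * indicator {-?r..?r} x \<partial>lborel) = ennreal (?F ?r - ?F (-?r))"
    using \<open>0 < s\<close>
    by (intro nn_integral_FTC_Icc fnn DERIV_subset[where s=UNIV and t = "{-?r..?r}"])
       (auto intro!: derivative_eq_intros simp: field_simps power2_eq_square)
  also have "?F ?r - ?F (-?r) = 2 * (7/10 - 343/6000) / sqrt (2 * pi)"
    using \<open>0 < s\<close> by (simp add: real_sqrt_mult power_mult_distrib field_simps power3_eq_cube)
  also have "(\<integral>\<^sup>+x. ennreal (?f x) * indicator {-?r..?r} x \<partial>lborel)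
      = (\<integral>\<^sup>+x. ennreal (?f x) * indicator {x. \<bar>x\<bar> < ?r} x \<partial>lborel)"
  proof (rule nn_integral_cong_AE)
    have "AE x in lborel. x \<noteq> ?r" "AE x in lborel. x \<noteq> -?r"
      by (rule AE_lborel_singleton)+
    then show "AE x in lborel. ennreal (?f x) * indicator {-?r..?r} x = ennreal (?f x) * indicator {x. \<bar>x\<bar> < ?r} x"
      by eventually_elim (auto simp: indicator_def)
  qed
  finally have I: "(\<integral>\<^sup>+x. ennreal (?f x) * indicator {x. \<bar>x\<bar> < ?r} x \<partial>lborel) = ennreal (2 * (7/10 - 343/6000) / sqrt (2 * pi))" .
  have "pi < 3.15" using pi_approx by simp
  then have "sqrt (2 * pi) \<le> 2.52"
    by (intro real_le_lsqrt) (auto simp: power2_eq_square)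
  then have "51/100 \<le> 2 * (7/10 - 343/6000) / sqrt (2 * pi)"
    by (simp add: field_simps)
  then have "ennreal (51/100) \<le> (\<integral>\<^sup>+x. ennreal (?f x) * indicator {x. \<bar>x\<bar> < ?r} x \<partial>lborel)"
    unfolding I by (rule ennreal_leI)
  also have "\<dots> \<le> (\<integral>\<^sup>+x. ennreal (normal_density 0 (sqrt s) x) * indicator {x. \<bar>x\<bar> < ?r} x \<partial>lborel)"
  proof (intro nn_integral_mono mult_right_mono ennreal_leI)
    fix x
    have "1 - x\<^sup>2 / (2 * s) \<le> exp (- (x\<^sup>2 / (2 * s)))" using exp_ge_add_one_self[of "- (x\<^sup>2 / (2 * s))"] by simp
    then show "?f x \<le> normal_density 0 (sqrt s) x"
      using \<open>0 < s\<close> by (auto simp: normal_density_def intro!: divide_right_mono)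
  qed auto
  also have "\<dots> = (\<integral>\<^sup>+\<omega>. indicator {x. \<bar>x\<bar> < ?r} (D \<omega>) \<partial>M)"
    by (rule distributed_nn_integral[OF D]) measurable
  also have "\<dots> = emeasure M {\<omega> \<in> space M. \<bar>D \<omega>\<bar> < ?r}"
    using emeasure_Collect_eq_nn_integral[of D M "{x. \<bar>x\<bar> < ?r}"] by simp
  finally show ?thesis by (simp add: emeasure_eq_measure)
qed

text \<open>A bound that decays at the Gaussian rate and also stays strictly below 1 on the whole range. For
\<open>a\<^sup>2 \<le> 9 s\<close> the central mass leaves room \<open>1/50\<close>, and \<open>450 = 9 * 50\<close>; beyond that range the prefactor
\<open>2 sqrt 2\<close> of the exponential bound is absorbed in \<open>exp (9/8)\<close>.\<close>

lemma twice_gaussian_tail: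
  assumes D: "distributed M lborel D (normal_density 0 (sqrt s))" and "0 < s" and a: "7/10 * sqrt s \<le> a"
  shows "2 * prob {\<omega> \<in> space M. a \<le> \<bar>D \<omega>\<bar>} \<le> exp (- (a\<^sup>2 / (450 * s)))"
proof -
  have [measurable]: "D \<in> borel_measurable M" using distributed_measurable[OF D] by simp
  have "0 \<le> a" by (rule order_trans[OF _ a]) (use \<open>0 < s\<close> in simp)
  let ?y = "a\<^sup>2 / s"
  have "0 \<le> ?y" using \<open>0 < s\<close> by simp
  show ?thesis
  proof (cases "?y \<le> 9")
    case True
    have "prob {\<omega> \<in> space M. a \<le> \<bar>D \<omega>\<bar>} \<le> prob (space M - {\<omega> \<in> space M. \<bar>D \<omega>\<bar> < 7/10 * sqrt s})"
      by (rule finite_measure_mono) (use a in auto)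
    also have "\<dots> = 1 - prob {\<omega> \<in> space M. \<bar>D \<omega>\<bar> < 7/10 * sqrt s}"
      by (rule prob_compl) measurable
    finally have "2 * prob {\<omega> \<in> space M. a \<le> \<bar>D \<omega>\<bar>} \<le> 1 + (- 1/50)"
      using gaussian_central_prob[OF D \<open>0 < s\<close>] by simp
    also have "\<dots> \<le> 1 + (- (?y / 450))" using True by simp
    also have "\<dots> \<le> exp (- (?y / 450))" by (rule exp_ge_add_one_self)
    finally show ?thesis by (simp add: mult.commute)
  next
    case False
    have s2: "sqrt 2 \<le> (142::real)/100" by (rule real_le_lsqrt) (auto simp: power2_eq_square)
    have "(284::real)/100 \<le> (1 + 9/16 + (9/16)\<^sup>2 / 2)\<^sup>2" by (simp add: power2_eq_square)
    also have "\<dots> \<le> (exp (9/16))\<^sup>2"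
      by (intro power_mono exp_lower_Taylor_quadratic) auto
    also have "\<dots> = exp (9/8)" using exp_double[of "9/16::real"] by simp
    also have "\<dots> \<le> exp (?y / 8)" using False by simp
    finally have e: "284/100 \<le> exp (?y / 8)" .
    have "2 * prob {\<omega> \<in> space M. a \<le> \<bar>D \<omega>\<bar>} \<le> 2 * (sqrt 2 * exp (- (a\<^sup>2 / (4 * s))))"
      using gaussian_chernoff[OF D \<open>0 < s\<close> \<open>0 \<le> a\<close>] by simp
    also have "\<dots> \<le> exp (?y / 8) * exp (- (a\<^sup>2 / (4 * s)))"
      using s2 e by simp
    also have "\<dots> = exp (- (?y / 8))" unfolding mult_exp_exp by (simp add: field_simps)
    also have "\<dots> \<le> exp (- (?y / 450))" using \<open>0 \<le> ?y\<close> by simp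
    finally show ?thesis by (simp add: mult.commute)
  qed
qed

end

section \<open>Random walks: independence of past and future\<close>

lemma measurable_sum_components:
  assumes "J \<subseteq> I"
  shows "(\<lambda>y. \<Sum>i\<in>J. y i) \<in> borel_measurable (PiM I (\<lambda>_. borel :: real measure))"
  using assms by (intro borel_measurable_sum measurable_component_singleton) auto

context prob_space
begin

lemma indep_var_nn_integral_mult:
  assumes "indep_var P X Q Y" and [measurable]: "f \<in> borel_measurable P" "g \<in> borel_measurable Q"
  shows "(\<integral>\<^sup>+\<omega>. f (X \<omega>) * g (Y \<omega>) \<partial>M) = (\<integral>\<^sup>+\<omega>. f (X \<omega>) \<partial>M) * (\<integral>\<^sup>+\<omega>. g (Y \<omega>) \<partial>M)"
proof -
  have XY[measurable]: "X \<in> measurable M P" "Y \<in> measurable M Q"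
    and D: "distr M P X \<Otimes>\<^sub>M distr M Q Y = distr M (P \<Otimes>\<^sub>M Q) (\<lambda>\<omega>. (X \<omega>, Y \<omega>))"
    using assms(1) unfolding indep_var_distribution_eq by auto
  interpret Y: prob_space "distr M Q Y" by (rule prob_space_distr) fact
  have "(\<integral>\<^sup>+\<omega>. f (X \<omega>) * g (Y \<omega>) \<partial>M)
      = (\<integral>\<^sup>+z. f (fst z) * g (snd z) \<partial>distr M (P \<Otimes>\<^sub>M Q) (\<lambda>\<omega>. (X \<omega>, Y \<omega>)))"
    by (subst nn_integral_distr) (auto intro!: measurable_Pair)
  also have "\<dots> = (\<integral>\<^sup>+x. \<integral>\<^sup>+y. f x * g y \<partial>distr M Q Y \<partial>distr M P X)"
    unfolding D[symmetric] by (subst Y.nn_integral_fst[symmetric]) auto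
  also have "\<dots> = (\<integral>\<^sup>+x. f x \<partial>distr M P X) * (\<integral>\<^sup>+y. g y \<partial>distr M Q Y)"
    by (simp add: nn_integral_cmult nn_integral_multc)
  also have "\<dots> = (\<integral>\<^sup>+\<omega>. f (X \<omega>) \<partial>M) * (\<integral>\<^sup>+\<omega>. g (Y \<omega>) \<partial>M)"
    by (simp add: nn_integral_distr)
  finally show ?thesis .
qed

text \<open>The Markov property of a random walk, in the form used below: a functional of the increments before
step \<open>k\<close> is independent of a functional of those from step \<open>k\<close> on.\<close>

lemma indep_past_future:
  assumes ind: "indep_vars (\<lambda>_. borel) X {..<n::nat}" and "k \<le> n"
  shows "indep_var (PiM {..<k} (\<lambda>_. borel)) (\<lambda>\<omega>. \<lambda>i\<in>{..<k}. X i \<omega>)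
    (PiM {k..<n} (\<lambda>_. borel)) (\<lambda>\<omega>. \<lambda>i\<in>{k..<n}. X i \<omega>)"
  using \<open>k \<le> n\<close> by (intro indep_var_restrict[OF ind]) auto

section \<open>Levy's maximal inequality\<close>

text \<open>Decompose according to the first step \<open>k\<close> at which the level \<open>a\<close> is exceeded, and according to the sign of
the walk at that step. The remaining displacement is independent of this and points outwards with
probability at least one half, in which case the walk is still beyond the level at the end.\<close>

lemma Levy_maximal_inequality:
  fixes S :: "nat \<Rightarrow> 'a \<Rightarrow> real"
  assumes ind: "indep_vars (\<lambda>_. borel) (\<lambda>i \<omega>. S (Suc i) \<omega> - S i \<omega>) {..<n}"
    and S[measurable]: "\<And>k. S k \<in> borel_measurable M"
    and pos: "\<And>k. k \<le> n \<Longrightarrow> 1/2 \<le> prob {\<omega>\<in>space M. 0 \<le> S n \<omega> - S k \<omega>}"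
    and neg: "\<And>k. k \<le> n \<Longrightarrow> 1/2 \<le> prob {\<omega>\<in>space M. S n \<omega> - S k \<omega> \<le> 0}"
    and "0 < a"
  shows "prob {\<omega>\<in>space M. \<exists>k\<le>n. a \<le> \<bar>S k \<omega> - S 0 \<omega>\<bar>} \<le> 2 * prob {\<omega>\<in>space M. a \<le> \<bar>S n \<omega> - S 0 \<omega>\<bar>}"
proof -
  define A where "A k = {\<omega>\<in>space M. (\<forall>j<k. \<bar>S j \<omega> - S 0 \<omega>\<bar> < a) \<and> a \<le> \<bar>S k \<omega> - S 0 \<omega>\<bar>}" for k
  define C where "C k = {\<omega>\<in>A k. a \<le> \<bar>S n \<omega> - S 0 \<omega>\<bar>}" for k
  have A[measurable]: "A k \<in> sets M" for k unfolding A_def by measurable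
  have C[measurable]: "C k \<in> sets M" for k
    using A[of k] unfolding C_def by measurable
  have AC: "prob (A k) \<le> 2 * prob (C k)" if "k \<le> n" for k
  proof -
    let ?I = "\<lambda>J \<omega>. \<lambda>i\<in>J. S (Suc i) \<omega> - S i \<omega>"
    let ?sum = "\<lambda>J (y::nat \<Rightarrow> real). \<Sum>i\<in>J. y i"
    \<comment> \<open>The sign s selects on which side the level is first exceeded.\<close>
    have half: "1/2 * prob {\<omega>\<in>A k. 0 \<le> s * (S k \<omega> - S 0 \<omega>)} \<le> 
        prob {\<omega>\<in>A k. 0 \<le> s * (S k \<omega> - S 0 \<omega>) \<and> 0 \<le> s * (S n \<omega> - S k \<omega>)}"
      if s: "s = 1 \<or> s = (-1::real)" for s
    proof -
      let ?P = "PiM {..<k} (\<lambda>_. borel :: real measure)"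
      let ?Q = "PiM {k..<n} (\<lambda>_. borel :: real measure)"
      define E where "E = {y\<in>space ?P. (\<forall>j\<in>{..<k}. \<bar>?sum {..<j} y\<bar> < a) \<and> a \<le> \<bar>?sum {..<k} y\<bar> \<and> 0 \<le> s * ?sum {..<k} y}"
      define F where "F = {y\<in>space ?Q. 0 \<le> s * ?sum {k..<n} y}"
      have m1: "?sum {..<j} \<in> borel_measurable ?P" if "j \<le> k" for j
        by (rule measurable_sum_components) (use that in auto)
      have [measurable]: "E \<in> sets ?P" unfolding E_def
        using m1 by (intro sets.sets_Collect_conj sets.sets_Collect_finite_All' sets.sets_Collect_finite_All borel_measurable_less borel_measurable_le borel_measurable_abs borel_measurable_times borel_measurable_const predE pred_intros_logic pred_intros_finite) auto
      have [measurable]: "F \<in> sets ?Q" unfolding F_def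
        using measurable_sum_components[of "{k..<n}" "{k..<n}"] by measurable
      have E': "?I {..<k} -` E \<inter> space M = {\<omega>\<in>A k. 0 \<le> s * (S k \<omega> - S 0 \<omega>)}"
        unfolding E_def A_def by (auto simp: space_PiM sum_lessThan_telescope[where f="\<lambda>i. S i _"])
      have F': "?I {k..<n} -` F \<inter> space M = {\<omega>\<in>space M. 0 \<le> s * (S n \<omega> - S k \<omega>)}"
        unfolding F_def using \<open>k \<le> n\<close> by (auto simp: space_PiM sum_Suc_diff'[where f="\<lambda>i. S i _"])
      have EF: "(\<lambda>\<omega>. (?I {..<k} \<omega>, ?I {k..<n} \<omega>)) -` (E \<times> F) \<inter> space M
         = {\<omega>\<in>A k. 0 \<le> s * (S k \<omega> - S 0 \<omega>) \<and> 0 \<le> s * (S n \<omega> - S k \<omega>)}"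
        using E' F' by blast
      have "1/2 \<le> prob (?I {k..<n} -` F \<inter> space M)"
        unfolding F' using s pos[OF \<open>k \<le> n\<close>] neg[OF \<open>k \<le> n\<close>] by auto
      then have "1/2 * prob (?I {..<k} -` E \<inter> space M) \<le> prob (?I {k..<n} -` F \<inter> space M) * prob (?I {..<k} -` E \<inter> space M)"
        by (intro mult_right_mono) auto
      also have "\<dots> = prob ((\<lambda>\<omega>. (?I {..<k} \<omega>, ?I {k..<n} \<omega>)) -` (E \<times> F) \<inter> space M)"
        using indep_varD[OF indep_past_future[OF ind \<open>k \<le> n\<close>], of E F] by simp
      finally show ?thesis unfolding E' EF .
    qed
    have A': "{\<omega>\<in>A k. 0 \<le> s * (S k \<omega> - S 0 \<omega>) \<and> 0 \<le> s * (S n \<omega> - S k \<omega>)} \<in> sets M"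
      "{\<omega>\<in>A k. 0 \<le> s * (S k \<omega> - S 0 \<omega>)} \<in> sets M" for s
      using A[of k] by measurable
    let ?U = "\<lambda>s. {\<omega>\<in>A k. 0 \<le> s * (S k \<omega> - S 0 \<omega>) \<and> 0 \<le> s * (S n \<omega> - S k \<omega>)}"
    have "prob (A k) = prob ({\<omega>\<in>A k. 0 \<le> 1 * (S k \<omega> - S 0 \<omega>)} \<union> {\<omega>\<in>A k. 0 \<le> -1 * (S k \<omega> - S 0 \<omega>)})"
      by (rule arg_cong[where f=prob]) auto
    also have "\<dots> \<le> prob {\<omega>\<in>A k. 0 \<le> 1 * (S k \<omega> - S 0 \<omega>)} + prob {\<omega>\<in>A k. 0 \<le> -1 * (S k \<omega> - S 0 \<omega>)}"
      by (intro measure_Un_le A')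
    also have "\<dots> \<le> 2 * (prob (?U 1) + prob (?U (-1)))"
      using half[of 1] half[of "-1"] by simp
    also have "prob (?U 1) + prob (?U (-1)) = prob (?U 1 \<union> ?U (-1))"
      using \<open>0 < a\<close> by (intro finite_measure_Union[symmetric] A') (auto simp: A_def)
    also have "\<dots> \<le> prob (C k)"
      by (intro finite_measure_mono C) (auto simp: C_def A_def)
    finally show ?thesis by simp
  qed
  have disj: "disjoint_family_on C {..n}"
    unfolding disjoint_family_on_def
  proof (intro ballI impI)
    fix i j :: nat assume "i \<noteq> j"
    then consider "i < j" | "j < i" by linarith
    then show "C i \<inter> C j = {}" by cases (fastforce simp: C_def A_def)+
  qed
  have "{\<omega>\<in>space M. \<exists>k\<le>n. a \<le> \<bar>S k \<omega> - S 0 \<omega>\<bar>} \<subseteq> (\<Union>k\<in>{..n}. A k)"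
  proof
    fix \<omega> assume "\<omega> \<in> {\<omega>\<in>space M. \<exists>k\<le>n. a \<le> \<bar>S k \<omega> - S 0 \<omega>\<bar>}"
    then obtain k where k: "k \<le> n" "a \<le> \<bar>S k \<omega> - S 0 \<omega>\<bar>" and sp: "\<omega> \<in> space M" by auto
    let ?l = "LEAST k. a \<le> \<bar>S k \<omega> - S 0 \<omega>\<bar>"
    have "a \<le> \<bar>S ?l \<omega> - S 0 \<omega>\<bar>" using k(2) by (rule LeastI)
    moreover have "?l \<le> k" using k(2) by (rule Least_le)
    moreover have "\<bar>S j \<omega> - S 0 \<omega>\<bar> < a" if "j < ?l" for j using not_less_Least[OF that] by simp
    ultimately have "\<omega> \<in> A ?l" "?l \<le> n" using k sp by (auto simp: A_def)
    then show "\<omega> \<in> (\<Union>k\<in>{..n}. A k)" by blast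
  qed
  then have "prob {\<omega>\<in>space M. \<exists>k\<le>n. a \<le> \<bar>S k \<omega> - S 0 \<omega>\<bar>} \<le> prob (\<Union>k\<in>{..n}. A k)"
    by (intro finite_measure_mono) auto
  also have "\<dots> \<le> (\<Sum>k\<in>{..n}. prob (A k))" by (rule finite_measure_subadditive_finite) auto
  also have "\<dots> \<le> (\<Sum>k\<in>{..n}. 2 * prob (C k))" by (intro sum_mono AC) auto
  also have "\<dots> = 2 * prob (\<Union>k\<in>{..n}. C k)"
    by (subst finite_measure_finite_Union) (auto simp: disj sum_distrib_left)
  also have "\<dots> \<le> 2 * prob {\<omega>\<in>space M. a \<le> \<bar>S n \<omega> - S 0 \<omega>\<bar>}"
    by (intro mult_left_mono finite_measure_mono) (auto simp: C_def A_def)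
  finally show ?thesis .
qed

end

section \<open>Moments of the number of returns under a drift\<close>

text \<open>The exponential is weakened to \<open>1 / (1 + a d)\<close>, because \<open>1 / ((1 + a x) sqrt x)\<close> has the explicit
antiderivative \<open>2 arctan (sqrt (a x)) / sqrt a\<close>; the sum is then bounded by telescoping.\<close>

lemma sum_exp_over_sqrt_le:
  fixes a :: real
  assumes "0 < a"
  shows "(\<Sum>d=1..D. exp (- (a * real d)) / sqrt (real d)) \<le> pi / sqrt a"
proof -
  let ?F = "\<lambda>x. 2 * arctan (sqrt a * sqrt x) / sqrt a"
  have step: "exp (- (a * real d)) / sqrt (real d) \<le> ?F (real d) - ?F (real d - 1)" if "1 \<le> d" for d :: nat
  proof -
    have der: "(?F has_real_derivative 1 / ((1 + a * x) * sqrt x)) (at x)" if "0 < x" for x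
    proof -
      have "(?F has_real_derivative 2 * (inverse (1 + (sqrt a * sqrt x)\<^sup>2) * (sqrt a * (inverse (sqrt x) / 2))) / sqrt a) (at x)"
        using that \<open>0 < a\<close> by (auto intro!: derivative_eq_intros simp: divide_simps)
      moreover have "2 * (inverse (1 + (sqrt a * sqrt x)\<^sup>2) * (sqrt a * (inverse (sqrt x) / 2))) / sqrt a = 1 / ((1 + a * x) * sqrt x)"
        using that \<open>0 < a\<close> by (simp add: power_mult_distrib divide_simps)
      ultimately show ?thesis by simp
    qed
    have "\<exists>l z. real d - 1 < z \<and> z < real d \<and> (?F has_real_derivative l) (at z) \<and> ?F (real d) - ?F (real d - 1) = (real d - (real d - 1)) * l"
    proof (rule MVT)
      show "continuous_on {real d - 1..real d} ?F" using \<open>0 < a\<close> by (intro continuous_intros) auto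
      show "?F differentiable (at x)" if "real d - 1 < x" "x < real d" for x
        using der[of x] that \<open>1 \<le> d\<close> by (auto simp: real_differentiable_def)
    qed simp
    then obtain l z where z: "real d - 1 < z" "z < real d" "(?F has_real_derivative l) (at z)"
      and eq: "?F (real d) - ?F (real d - 1) = l" by auto
    have "0 < z" using z \<open>1 \<le> d\<close> by auto
    have l: "l = 1 / ((1 + a * z) * sqrt z)" using DERIV_unique[OF z(3) der[OF \<open>0 < z\<close>]] .
    have "exp (- (a * real d)) \<le> 1 / (1 + a * real d)"
      using exp_ge_add_one_self[of "a * real d"] \<open>0 < a\<close> by (simp add: exp_minus field_simps add_pos_nonneg)
    then have "exp (- (a * real d)) / sqrt (real d) \<le> 1 / ((1 + a * real d) * sqrt (real d))"
      using divide_right_mono[of "exp (- (a * real d))" "1 / (1 + a * real d)" "sqrt (real d)"] by simp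
    also have "\<dots> \<le> l" unfolding l
      using z \<open>0 < z\<close> \<open>0 < a\<close> by (intro divide_left_mono mult_mono) (auto intro!: add_pos_nonneg mult_pos_pos)
    finally show ?thesis using eq by simp
  qed
  have "(\<Sum>d=1..D. exp (- (a * real d)) / sqrt (real d)) \<le> ?F (real D)"
  proof (induction D)
    case (Suc D) then show ?case using step[of "Suc D"] by simp
  qed simp
  also have "\<dots> \<le> pi / sqrt a"
    using arctan_ubound[of "sqrt a * sqrt (real D)"] \<open>0 < a\<close> by (intro divide_right_mono) auto
  finally show ?thesis .
qed

lemma add_power_Suc_le:
  fixes a b :: ennreal
  shows "(a + b) ^ Suc p \<le> b ^ Suc p + of_nat (Suc p) * a * (a + b) ^ p"
proof (induction p)
  case (Suc p)
  have "(a + b) ^ Suc (Suc p) = a * (a + b) ^ Suc p + b * (a + b) ^ Suc p"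
    by (simp add: algebra_simps)
  also have "\<dots> \<le> a * (a + b) ^ Suc p + b * (b ^ Suc p + of_nat (Suc p) * a * (a + b) ^ p)"
    by (intro add_left_mono mult_left_mono Suc.IH) auto
  also have "\<dots> = b ^ Suc (Suc p) + a * (a + b) ^ Suc p + of_nat (Suc p) * a * (b * (a + b) ^ p)"
    by (simp add: algebra_simps)
  also have "\<dots> \<le> b ^ Suc (Suc p) + a * (a + b) ^ Suc p + of_nat (Suc p) * a * ((a + b) * (a + b) ^ p)"
    by (intro add_left_mono mult_left_mono mult_right_mono) auto
  also have "\<dots> = b ^ Suc (Suc p) + of_nat (Suc (Suc p)) * a * (a + b) ^ Suc p"
    by (simp add: algebra_simps)
  finally show ?case .
qed simp

text \<open>Order the factors of the power in time: the sum over tuples is at most \<open>p + 1\<close> times the sum over the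
earliest index \<open>i\<close> of its term and the \<open>p\<close>-th power of the later terms. This replaces an expansion into
ordered tuples by a recursion in the exponent.\<close>

lemma sum_power_Suc_le:
  fixes a :: "nat \<Rightarrow> ennreal"
  assumes "k \<le> n"
  shows "(\<Sum>i=k..<n. a i) ^ Suc p \<le> of_nat (Suc p) * (\<Sum>i=k..<n. a i * (\<Sum>l=i..<n. a l) ^ p)"
  using assms
proof (induction k rule: inc_induct)
  case (step k)
  have eq: "(\<Sum>i=k..<n. f i) = f k + (\<Sum>i=Suc k..<n. f i)" for f :: "nat \<Rightarrow> ennreal"
    using step.hyps by (simp add: sum.atLeast_Suc_lessThan)
  have "(\<Sum>i=k..<n. a i) ^ Suc p \<le> (\<Sum>i=Suc k..<n. a i) ^ Suc p + of_nat (Suc p) * a k * (\<Sum>i=k..<n. a i) ^ p"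
    unfolding eq[of a] by (rule add_power_Suc_le)
  also have "\<dots> \<le> of_nat (Suc p) * (\<Sum>i=Suc k..<n. a i * (\<Sum>l=i..<n. a l) ^ p) + of_nat (Suc p) * a k * (\<Sum>i=k..<n. a i) ^ p"
    by (intro add_right_mono step.IH)
  also have "\<dots> = of_nat (Suc p) * (\<Sum>i=k..<n. a i * (\<Sum>l=i..<n. a l) ^ p)"
    unfolding eq[of "\<lambda>i. a i * (\<Sum>l=i..<n. a l) ^ p"] by (simp add: algebra_simps)
  finally show ?case .
qed simp

definition returns :: "(nat \<Rightarrow> real) \<Rightarrow> nat \<Rightarrow> nat \<Rightarrow> real \<Rightarrow> ennreal" where
  "returns s n k r = (\<Sum>i=k..<n. indicator {x. \<bar>x\<bar> < r} (s i - s k))"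

text \<open>Points close to \<open>s k\<close> are close to each other, at the price of doubling the window. Afterwards the later
factor refers to the path after time \<open>i\<close> only, so that independence applies.\<close>

lemma returns_power_Suc_le:
  assumes "k \<le> n"
  shows "returns s n k r ^ Suc p
    \<le> of_nat (Suc p) * (\<Sum>i=k..<n. indicator {x. \<bar>x\<bar> < r} (s i - s k) * returns s n i (2 * r) ^ p)"
proof -
  let ?a = "\<lambda>i. indicator {x. \<bar>x\<bar> < r} (s i - s k) :: ennreal"
  have "returns s n k r ^ Suc p \<le> of_nat (Suc p) * (\<Sum>i=k..<n. ?a i * (\<Sum>l=i..<n. ?a l) ^ p)"
    unfolding returns_def by (rule sum_power_Suc_le[OF assms])
  also have "\<dots> \<le> of_nat (Suc p) * (\<Sum>i=k..<n. ?a i * returns s n i (2 * r) ^ p)"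
  proof (rule mult_left_mono[OF sum_mono])
    fix i
    show "?a i * (\<Sum>l=i..<n. ?a l) ^ p \<le> ?a i * returns s n i (2 * r) ^ p"
    proof (cases "\<bar>s i - s k\<bar> < r")
      case True
      then have "?a l \<le> indicator {x. \<bar>x\<bar> < 2 * r} (s l - s i)" for l
        by (auto simp: indicator_def)
      then have "(\<Sum>l=i..<n. ?a l) \<le> returns s n i (2 * r)"
        unfolding returns_def by (rule sum_mono)
      then show ?thesis by (intro mult_left_mono power_mono) auto
    qed auto
  qed auto
  finally show ?thesis .
qed

text \<open>Integrating over the location \<open>x\<close> removes the first visit: what is left are returns to the position at
the first visit, and no distribution of positions enters.\<close>

lemma occupation_power_integral_le:
  fixes s :: "nat \<Rightarrow> real"
  assumes "0 \<le> r"
  shows "(\<integral>\<^sup>+x. (\<Sum>i<n. indicator {y. \<bar>y\<bar> < r} (s i - x)) ^ Suc p \<partial>lborel)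
    \<le> of_nat (Suc p) * (\<Sum>k<n. ennreal (2 * r) * returns s n k (2 * r) ^ p)"
proof -
  let ?a = "\<lambda>i x. indicator {y. \<bar>y\<bar> < r} (s i - x) :: ennreal"
  have I: "(\<integral>\<^sup>+x. ?a k x \<partial>lborel) = ennreal (2 * r)" for k
  proof -
    have "(\<integral>\<^sup>+x. ?a k x \<partial>lborel) = (\<integral>\<^sup>+x. indicator {s k - r<..<s k + r} x \<partial>lborel)"
      by (intro nn_integral_cong) (auto simp: indicator_def)
    then show ?thesis using \<open>0 \<le> r\<close> by simp
  qed
  have "(\<integral>\<^sup>+x. (\<Sum>i<n. ?a i x) ^ Suc p \<partial>lborel)
    \<le> (\<integral>\<^sup>+x. of_nat (Suc p) * (\<Sum>k<n. ?a k x * returns s n k (2 * r) ^ p) \<partial>lborel)"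
  proof (intro nn_integral_mono)
    fix x
    have "(\<Sum>i<n. ?a i x) ^ Suc p \<le> of_nat (Suc p) * (\<Sum>k<n. ?a k x * (\<Sum>l=k..<n. ?a l x) ^ p)"
      using sum_power_Suc_le[of 0 n "\<lambda>i. ?a i x" p] by (simp add: lessThan_atLeast0)
    also have "\<dots> \<le> of_nat (Suc p) * (\<Sum>k<n. ?a k x * returns s n k (2 * r) ^ p)"
    proof (rule mult_left_mono[OF sum_mono])
      fix k
      show "?a k x * (\<Sum>l=k..<n. ?a l x) ^ p \<le> ?a k x * returns s n k (2 * r) ^ p"
      proof (cases "\<bar>s k - x\<bar> < r")
        case True
        then have "?a l x \<le> indicator {x. \<bar>x\<bar> < 2 * r} (s l - s k)" for l
          by (auto simp: indicator_def)
        then have "(\<Sum>l=k..<n. ?a l x) \<le> returns s n k (2 * r)"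
          unfolding returns_def by (rule sum_mono)
        then show ?thesis by (intro mult_left_mono power_mono) auto
      qed auto
    qed auto
    finally show "(\<Sum>i<n. ?a i x) ^ Suc p \<le> of_nat (Suc p) * (\<Sum>k<n. ?a k x * returns s n k (2 * r) ^ p)" .
  qed
  also have "\<dots> = of_nat (Suc p) * (\<Sum>k<n. (\<integral>\<^sup>+x. ?a k x \<partial>lborel) * returns s n k (2 * r) ^ p)"
    by (subst nn_integral_cmult, measurable, subst nn_integral_sum, measurable) (simp add: nn_integral_multc)
  also have "\<dots> = of_nat (Suc p) * (\<Sum>k<n. ennreal (2 * r) * returns s n k (2 * r) ^ p)"
    by (simp only: I)
  finally show ?thesis .
qed

text \<open>The density of a walk with drift \<open>\<mu>\<close> and time step \<open>h\<close> relative to the centred Gaussian walk, restricted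
to the steps from \<open>j\<close> to \<open>l\<close>.\<close>

definition drift_weight :: "real \<Rightarrow> real \<Rightarrow> (nat \<Rightarrow> real) \<Rightarrow> nat \<Rightarrow> nat \<Rightarrow> real" where
  "drift_weight \<mu> h s j l = exp (\<mu> * (s l - s j) - \<mu>\<^sup>2 * (real (l - j) * h) / 2)"

lemma drift_weight_mult:
  assumes "j \<le> k" "k \<le> l"
  shows "drift_weight \<mu> h s j k * drift_weight \<mu> h s k l = drift_weight \<mu> h s j l"
  using assms by (simp add: drift_weight_def mult_exp_exp of_nat_diff field_simps)

lemma ennreal_drift_weight_mult:
  assumes "j \<le> k" "k \<le> l"
  shows "ennreal (drift_weight \<mu> h s j l) = ennreal (drift_weight \<mu> h s j k) * ennreal (drift_weight \<mu> h s k l)"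
  unfolding drift_weight_mult[OF assms, symmetric] by (rule ennreal_mult) (simp_all add: drift_weight_def)

text \<open>A bound for the expected number of returns to a window of radius \<open>r\<close> under the drift. The summand 1
counts the time 0; the rest is a Riemann sum of the Green function, of order \<open>1 / (\<mu> h)\<close> per unit length.\<close>

definition return_bound :: "real \<Rightarrow> real \<Rightarrow> real \<Rightarrow> real" where
  "return_bound \<mu> h r = 1 + 4 * r * exp (\<mu> * r) / (\<mu> * h)"

lemma sum_gaussian_return_le:
  fixes \<mu> h r :: real
  assumes "0 < \<mu>" "0 < h" "0 \<le> r"
  shows "(\<Sum>d=1..D. 2 * r * exp (\<mu> * r) * exp (- (\<mu>\<^sup>2 * (real d * h) / 2)) / sqrt (2 * pi * (real d * h)))
    \<le> 4 * r * exp (\<mu> * r) / (\<mu> * h)"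
proof -
  let ?a = "\<mu>\<^sup>2 * h / 2" and ?c = "2 * r * exp (\<mu> * r) / sqrt (2 * pi * h)"
  have "(\<Sum>d=1..D. 2 * r * exp (\<mu> * r) * exp (- (\<mu>\<^sup>2 * (real d * h) / 2)) / sqrt (2 * pi * (real d * h)))
      = ?c * (\<Sum>d=1..D. exp (- (?a * real d)) / sqrt (real d))"
    by (simp add: sum_distrib_left real_sqrt_mult mult_ac)
  also have "\<dots> \<le> ?c * (pi / sqrt ?a)"
    using assms by (intro mult_left_mono sum_exp_over_sqrt_le) auto
  also have "\<dots> = 2 * r * exp (\<mu> * r) / (\<mu> * h) * sqrt pi"
  proof -
    have "sqrt (2 * pi * h) * sqrt ?a = sqrt (pi * (\<mu> * h)\<^sup>2)"
      unfolding real_sqrt_mult[symmetric] by (simp add: power2_eq_square mult_ac)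
    also have "\<dots> = sqrt pi * (\<mu> * h)" using assms by (simp add: real_sqrt_mult)
    finally have "?c * (pi / sqrt ?a) = 2 * r * exp (\<mu> * r) * pi / (sqrt pi * (\<mu> * h))"
      by (simp add: divide_divide_eq_left)
    also have "\<dots> = 2 * r * exp (\<mu> * r) / (\<mu> * h) * (pi / sqrt pi)" by simp
    finally show ?thesis by (simp add: real_div_sqrt)
  qed
  also have "\<dots> \<le> 2 * r * exp (\<mu> * r) / (\<mu> * h) * 2"
  proof -
    have "sqrt pi \<le> 2" using pi_less_4 by (intro real_le_lsqrt) auto
    then show ?thesis using assms by (intro mult_left_mono) auto
  qed
  finally show ?thesis by simp
qed

context prob_space
begin

context
  fixes S :: "nat \<Rightarrow> 'a \<Rightarrow> real" and n :: nat and h \<mu> :: real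
  assumes ind: "indep_vars (\<lambda>_. borel) (\<lambda>i \<omega>. S (Suc i) \<omega> - S i \<omega>) {..<n}"
    and S[measurable]: "\<And>k. S k \<in> borel_measurable M"
    and gauss: "\<And>j l. j < l \<Longrightarrow> l \<le> n \<Longrightarrow>
      distributed M lborel (\<lambda>\<omega>. S l \<omega> - S j \<omega>) (normal_density 0 (sqrt (real (l - j) * h)))"
    and h: "0 < h" and \<mu>: "0 < \<mu>"
begin

abbreviation (input) "W j l \<omega> \<equiv> ennreal (drift_weight \<mu> h (\<lambda>k. S k \<omega>) j l)"

lemma drift_weight_mean:
  assumes "j \<le> l" "l \<le> n"
  shows "(\<integral>\<^sup>+\<omega>. W j l \<omega> \<partial>M) = 1"
proof (cases "j = l")
  case False
  then show ?thesis
    using tilted_gaussian_mean[OF gauss[of j l], of \<mu>] assms h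
    by (simp add: drift_weight_def)
qed (simp add: drift_weight_def emeasure_space_1)

lemma sum_drift_return_le:
  assumes "k \<le> n" "0 \<le> r"
  shows "(\<Sum>i=k..<n. \<integral>\<^sup>+\<omega>. W k i \<omega> * indicator {x. \<bar>x\<bar> < r} (S i \<omega> - S k \<omega>) \<partial>M) \<le> ennreal (return_bound \<mu> h r)"
proof (cases "k < n")
  case True
  let ?g = "\<lambda>d. 2 * r * exp (\<mu> * r) * exp (- (\<mu>\<^sup>2 * (real d * h) / 2)) / sqrt (2 * pi * (real d * h))"
  let ?I = "\<lambda>i. \<integral>\<^sup>+\<omega>. W k i \<omega> * indicator {x. \<bar>x\<bar> < r} (S i \<omega> - S k \<omega>) \<partial>M"
  have "?I k \<le> (\<integral>\<^sup>+\<omega>. 1 \<partial>M)"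
    by (intro nn_integral_mono) (auto simp: drift_weight_def indicator_def)
  then have I0: "?I k \<le> ennreal 1" by (simp add: emeasure_space_1)
  have I: "?I i \<le> ennreal (?g (i - k))" if "i \<in> {Suc k..<n}" for i
    using tilted_gaussian_small[OF gauss[of k i], of \<mu> r] that h \<mu> \<open>0 \<le> r\<close>
    by (simp add: drift_weight_def)
  have "(\<Sum>i=k..<n. ?I i) = ?I k + (\<Sum>i=Suc k..<n. ?I i)"
    using True by (simp add: sum.atLeast_Suc_lessThan)
  also have "\<dots> \<le> ennreal 1 + (\<Sum>i=Suc k..<n. ennreal (?g (i - k)))"
    by (intro add_mono I0 sum_mono I)
  also have "(\<Sum>i=Suc k..<n. ennreal (?g (i - k))) = (\<Sum>d=1..n - Suc k. ennreal (?g d))"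
    by (rule sum.reindex_bij_witness[of _ "\<lambda>d. d + k" "\<lambda>i. i - k"]) (use True in auto)
  also have "\<dots> = ennreal (\<Sum>d=1..n - Suc k. ?g d)"
    using \<open>0 \<le> r\<close> h by (intro sum_ennreal) auto
  also have "ennreal 1 + \<dots> \<le> ennreal 1 + ennreal (4 * r * exp (\<mu> * r) / (\<mu> * h))"
    using sum_gaussian_return_le[OF \<mu> h \<open>0 \<le> r\<close>] by (intro add_left_mono ennreal_leI)
  also have "\<dots> = ennreal (return_bound \<mu> h r)"
    unfolding return_bound_def using \<mu> h \<open>0 \<le> r\<close> by (intro ennreal_plus[symmetric]) auto
  finally show ?thesis .
qed simp

lemma measurable_returns[measurable]:
  "(\<lambda>\<omega>. returns (\<lambda>k. S k \<omega>) n j r) \<in> borel_measurable M"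
  unfolding returns_def by measurable

lemma measurable_drift_weight[measurable]:
  "(\<lambda>\<omega>. drift_weight \<mu> h (\<lambda>k. S k \<omega>) j l) \<in> borel_measurable M"
  unfolding drift_weight_def by measurable

text \<open>The weight is multiplicative along the walk, so it splits together with the path and the Markov
property holds for the walk with drift as well.\<close>

lemma drift_markov:
  assumes "k \<le> j" "j \<le> n" and [measurable]: "\<phi> \<in> borel_measurable borel"
  shows "(\<integral>\<^sup>+\<omega>. (W k j \<omega> * \<phi> (S j \<omega> - S k \<omega>)) * (W j n \<omega> * returns (\<lambda>k. S k \<omega>) n j r ^ p) \<partial>M)
    = (\<integral>\<^sup>+\<omega>. W k j \<omega> * \<phi> (S j \<omega> - S k \<omega>) \<partial>M) * (\<integral>\<^sup>+\<omega>. W j n \<omega> * returns (\<lambda>k. S k \<omega>) n j r ^ p \<partial>M)"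
proof -
  let ?P = "PiM {..<j} (\<lambda>_. borel :: real measure)"
  let ?Q = "PiM {j..<n} (\<lambda>_. borel :: real measure)"
  let ?I = "\<lambda>J \<omega>. \<lambda>i\<in>J. S (Suc i) \<omega> - S i \<omega>"
  let ?e = "\<lambda>d x. ennreal (exp (\<mu> * x - \<mu>\<^sup>2 * (real d * h) / 2))"
  define f where "f y = ?e (j - k) (\<Sum>i=k..<j. y i) * \<phi> (\<Sum>i=k..<j. y i)" for y :: "nat \<Rightarrow> real"
  define g where "g y = ?e (n - j) (\<Sum>i=j..<n. y i) *
     (\<Sum>l=j..<n. indicator {x. \<bar>x\<bar> < r} (\<Sum>i=j..<l. y i)) ^ p" for y :: "nat \<Rightarrow> real"
  have m1[measurable]: "(\<lambda>y. \<Sum>i=k..<j. y i) \<in> borel_measurable ?P"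
    by (rule measurable_sum_components) auto
  have f: "f \<in> borel_measurable ?P" unfolding f_def by measurable
  have m2: "(\<lambda>y. \<Sum>i=j..<l. y i) \<in> borel_measurable ?Q" if "l \<le> n" for l
    by (rule measurable_sum_components) (use that in auto)
  have m3: "(\<lambda>y. indicator {x. \<bar>x\<bar> < r} (\<Sum>i=j..<l. y i) :: ennreal) \<in> borel_measurable ?Q" if "l \<in> {j..<n}" for l
    by (rule measurable_compose[OF m2]) (use that in auto)
  have m4: "(\<lambda>y. \<Sum>l=j..<n. indicator {x. \<bar>x\<bar> < r} (\<Sum>i=j..<l. y i) :: ennreal) \<in> borel_measurable ?Q"
    by (rule borel_measurable_sum[OF m3])
  have g: "g \<in> borel_measurable ?Q"
    unfolding g_def using m2[of n] m4 by measurable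
  have tele: "(\<Sum>i=a..<b. ?I J \<omega> i) = S b \<omega> - S a \<omega>" if "a \<le> b" "{a..<b} \<subseteq> J" for a b J \<omega>
  proof -
    have "(\<Sum>i=a..<b. ?I J \<omega> i) = (\<Sum>i=a..<b. S (Suc i) \<omega> - S i \<omega>)"
      by (rule sum.cong) (use that in auto)
    then show ?thesis using sum_Suc_diff'[of a b "\<lambda>i. S i \<omega>"] that by simp
  qed
  have f': "f (?I {..<j} \<omega>) = W k j \<omega> * \<phi> (S j \<omega> - S k \<omega>)" for \<omega>
    unfolding f_def drift_weight_def using \<open>k \<le> j\<close> by (subst (1 2) tele) auto
  have "(\<Sum>l=j..<n. indicator {x. \<bar>x\<bar> < r} (\<Sum>i=j..<l. ?I {j..<n} \<omega> i)) = returns (\<lambda>k. S k \<omega>) n j r" for \<omega>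
    unfolding returns_def by (rule sum.cong) (auto simp: tele simp del: restrict_apply)
  then have g': "g (?I {j..<n} \<omega>) = W j n \<omega> * returns (\<lambda>k. S k \<omega>) n j r ^ p" for \<omega>
    unfolding g_def drift_weight_def using \<open>j \<le> n\<close> by (simp add: tele del: restrict_apply)
  show ?thesis
    using indep_var_nn_integral_mult[OF indep_past_future[OF ind \<open>j \<le> n\<close>] f g]
    unfolding f' g' .
qed

text \<open>Induction on the exponent: each step splits off the first return, whose expected number is controlled
by the Green function bound, and restarts the walk there with a doubled window.\<close>

lemma drift_returns_moment:
  assumes "k \<le> n" "0 \<le> r"
  shows "(\<integral>\<^sup>+\<omega>. W k n \<omega> * returns (\<lambda>k. S k \<omega>) n k r ^ p \<partial>M)
    \<le> ennreal (fact p * (\<Prod>i<p. return_bound \<mu> h (2 ^ i * r)))"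
  using assms
proof (induction p arbitrary: k r)
  case 0
  then show ?case by (simp add: drift_weight_mean)
next
  case (Suc p)
  let ?R = "\<lambda>\<omega> k r. returns (\<lambda>k. S k \<omega>) n k r"
  let ?ind = "\<lambda>i \<omega>. indicator {x. \<bar>x\<bar> < r} (S i \<omega> - S k \<omega>) :: ennreal"
  let ?C = "fact p * (\<Prod>i<p. return_bound \<mu> h (2 ^ i * (2 * r)))"
  have rb: "0 \<le> return_bound \<mu> h (2 ^ i * r)" for i
    using \<mu> h Suc.prems unfolding return_bound_def by (intro add_nonneg_nonneg) auto
  have rb': "0 \<le> return_bound \<mu> h (2 ^ i * (2 * r))" for i using rb[of "Suc i"] by (simp add: mult_ac)
  have "(\<integral>\<^sup>+\<omega>. W k n \<omega> * ?R \<omega> k r ^ Suc p \<partial>M)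
     \<le> (\<integral>\<^sup>+\<omega>. of_nat (Suc p) * (\<Sum>i=k..<n. (W k i \<omega> * ?ind i \<omega>) * (W i n \<omega> * ?R \<omega> i (2 * r) ^ p)) \<partial>M)"
  proof (intro nn_integral_mono)
    fix \<omega>
    have W: "W k n \<omega> = W k i \<omega> * W i n \<omega>" if "i \<in> {k..<n}" for i
      using that by (intro ennreal_drift_weight_mult) auto
    have "W k n \<omega> * ?R \<omega> k r ^ Suc p \<le> W k n \<omega> * (of_nat (Suc p) * (\<Sum>i=k..<n. ?ind i \<omega> * ?R \<omega> i (2 * r) ^ p))"
      by (intro mult_left_mono returns_power_Suc_le Suc.prems) auto
    also have "\<dots> = of_nat (Suc p) * (\<Sum>i=k..<n. W k n \<omega> * (?ind i \<omega> * ?R \<omega> i (2 * r) ^ p))"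
      by (simp only: mult.left_commute[of "W k n \<omega>"] sum_distrib_left[of "W k n \<omega>"])
    also have "\<dots> = of_nat (Suc p) * (\<Sum>i=k..<n. (W k i \<omega> * ?ind i \<omega>) * (W i n \<omega> * ?R \<omega> i (2 * r) ^ p))"
      by (rule arg_cong[where f="(*) _"], rule sum.cong) (auto simp: W mult_ac)
    finally show "W k n \<omega> * ?R \<omega> k r ^ Suc p \<le> of_nat (Suc p) * (\<Sum>i=k..<n. (W k i \<omega> * ?ind i \<omega>) * (W i n \<omega> * ?R \<omega> i (2 * r) ^ p))" .
  qed
  also have "\<dots> = of_nat (Suc p) * (\<Sum>i=k..<n. \<integral>\<^sup>+\<omega>. (W k i \<omega> * ?ind i \<omega>) * (W i n \<omega> * ?R \<omega> i (2 * r) ^ p) \<partial>M)"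
    by (subst nn_integral_cmult, measurable, subst nn_integral_sum, measurable)
  also have "\<dots> = of_nat (Suc p) * (\<Sum>i=k..<n. (\<integral>\<^sup>+\<omega>. W k i \<omega> * ?ind i \<omega> \<partial>M) * (\<integral>\<^sup>+\<omega>. W i n \<omega> * ?R \<omega> i (2 * r) ^ p \<partial>M))"
    by (rule arg_cong[where f="(*) _"], rule sum.cong) (auto simp: drift_markov)
  also have "\<dots> \<le> of_nat (Suc p) * (\<Sum>i=k..<n. (\<integral>\<^sup>+\<omega>. W k i \<omega> * ?ind i \<omega> \<partial>M) * ennreal ?C)"
    using Suc.prems by (intro mult_left_mono sum_mono Suc.IH) auto
  also have "\<dots> = of_nat (Suc p) * ((\<Sum>i=k..<n. (\<integral>\<^sup>+\<omega>. W k i \<omega> * ?ind i \<omega> \<partial>M)) * ennreal ?C)"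
    by (simp add: sum_distrib_right)
  also have "\<dots> \<le> of_nat (Suc p) * (ennreal (return_bound \<mu> h r) * ennreal ?C)"
    using Suc.prems by (intro mult_left_mono mult_right_mono sum_drift_return_le) auto
  also have "\<dots> = ennreal (real (Suc p) * (return_bound \<mu> h r * ?C))"
    using rb[of 0] rb' by (simp add: ennreal_of_nat_eq_real_of_nat ennreal_mult prod_nonneg del: of_nat_Suc)
  also have "real (Suc p) * (return_bound \<mu> h r * ?C) = fact (Suc p) * (\<Prod>i<Suc p. return_bound \<mu> h (2 ^ i * r))"
    by (subst prod.lessThan_Suc_shift) (simp add: mult_ac)
  finally show ?case .
qed

text \<open>The weight collected before step \<open>k\<close> is independent of the returns and has mean 1.\<close>

lemma drift_returns_moment_from_start:
  assumes "k \<le> n" "0 \<le> r"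
  shows "(\<integral>\<^sup>+\<omega>. W 0 n \<omega> * returns (\<lambda>k. S k \<omega>) n k r ^ p \<partial>M)
    \<le> ennreal (fact p * (\<Prod>i<p. return_bound \<mu> h (2 ^ i * r)))"
proof -
  have "W 0 n \<omega> = (W 0 k \<omega> * 1) * W k n \<omega>" for \<omega>
    using ennreal_drift_weight_mult[of 0 k n] \<open>k \<le> n\<close> by simp
  then have "(\<integral>\<^sup>+\<omega>. W 0 n \<omega> * returns (\<lambda>k. S k \<omega>) n k r ^ p \<partial>M)
     = (\<integral>\<^sup>+\<omega>. (W 0 k \<omega> * 1) * (W k n \<omega> * returns (\<lambda>k. S k \<omega>) n k r ^ p) \<partial>M)"
    by (simp add: mult_ac)
  also have "\<dots> = (\<integral>\<^sup>+\<omega>. W k n \<omega> * returns (\<lambda>k. S k \<omega>) n k r ^ p \<partial>M)"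
    using drift_markov[of 0 k "\<lambda>_. 1" r p] drift_weight_mean[of 0 k] \<open>k \<le> n\<close> by simp
  also have "\<dots> \<le> ennreal (fact p * (\<Prod>i<p. return_bound \<mu> h (2 ^ i * r)))"
    by (rule drift_returns_moment[OF assms])
  finally show ?thesis .
qed

text \<open>The random walk version of the moment bound for the local time of drifted Brownian motion.\<close>

theorem drift_occupation_moment:
  assumes "0 \<le> r"
  shows "(\<integral>\<^sup>+\<omega>. W 0 n \<omega> * (\<integral>\<^sup>+x. (\<Sum>i<n. indicator {y. \<bar>y\<bar> < r} (S i \<omega> - x)) ^ Suc p \<partial>lborel) \<partial>M)
    \<le> ennreal (fact (Suc p) * (real n * (2 * r)) * (\<Prod>i<p. return_bound \<mu> h (2 ^ i * (2 * r))))"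
proof -
  let ?R = "\<lambda>\<omega> k. returns (\<lambda>k. S k \<omega>) n k (2 * r) ^ p"
  let ?C = "\<Prod>i<p. return_bound \<mu> h (2 ^ i * (2 * r))"
  have C: "0 \<le> ?C"
    using \<mu> h assms unfolding return_bound_def by (intro prod_nonneg add_nonneg_nonneg) auto
  have "(\<integral>\<^sup>+\<omega>. W 0 n \<omega> * (\<integral>\<^sup>+x. (\<Sum>i<n. indicator {y. \<bar>y\<bar> < r} (S i \<omega> - x)) ^ Suc p \<partial>lborel) \<partial>M)
     \<le> (\<integral>\<^sup>+\<omega>. W 0 n \<omega> * (of_nat (Suc p) * (\<Sum>k<n. ennreal (2 * r) * ?R \<omega> k)) \<partial>M)"
    by (intro nn_integral_mono mult_left_mono occupation_power_integral_le assms) auto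
  also have "\<dots> = (\<integral>\<^sup>+\<omega>. (of_nat (Suc p) * ennreal (2 * r)) * (\<Sum>k<n. W 0 n \<omega> * ?R \<omega> k) \<partial>M)"
    by (intro nn_integral_cong) (simp only: sum_distrib_left mult_ac)
  also have "\<dots> = (of_nat (Suc p) * ennreal (2 * r)) * (\<Sum>k<n. \<integral>\<^sup>+\<omega>. W 0 n \<omega> * ?R \<omega> k \<partial>M)"
    by (subst nn_integral_cmult, measurable, subst nn_integral_sum, measurable)
  also have "\<dots> \<le> (of_nat (Suc p) * ennreal (2 * r)) * (\<Sum>k<n. ennreal (fact p * ?C))"
    using assms by (intro mult_left_mono sum_mono drift_returns_moment_from_start) auto
  also have "\<dots> = ennreal (real (Suc p) * (2 * r) * (real n * (fact p * ?C)))"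
    using assms C by (simp add: ennreal_of_nat_eq_real_of_nat ennreal_mult del: of_nat_Suc)
  also have "real (Suc p) * (2 * r) * (real n * (fact p * ?C)) = fact (Suc p) * (real n * (2 * r)) * ?C"
    by (simp add: mult_ac)
  finally show ?thesis .
qed

end

end

section \<open>Deterministic properties of a path with a local time\<close>

text \<open>Everything that holds for a single path is proved for a fixed continuous function, so that probability
enters only through the statement that almost every Brownian path satisfies these assumptions.\<close>

locale local_time_path =
  fixes b :: "real \<Rightarrow> real" and l :: "real \<Rightarrow> real \<Rightarrow> real"
  assumes start: "b 0 = 0"
    and cont: "continuous_on {0..} b"
    and leaves: "\<exists>t\<ge>0. 1 \<le> \<bar>b t\<bar>"
    and l_cont: "continuous_on (UNIV \<times> {0..}) (\<lambda>(x, t). l x t)"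
    and l_nonneg: "\<And>x t. 0 \<le> t \<Longrightarrow> 0 \<le> l x t"
    and l_density: "\<And>t. 0 \<le> t \<Longrightarrow>
      distr (restrict_space lborel {0..t}) lborel b = density lborel (\<lambda>x. ennreal (l x t))"
begin

definition exit :: real where "exit = Inf {t. 0 \<le> t \<and> \<bar>b t\<bar> = 1}"

lemma borel_b: "b \<in> borel_measurable (restrict_space lborel {0..t})"
proof -
  have "b \<in> borel_measurable (restrict_space borel {0..t})"
    by (rule borel_measurable_continuous_on_restrict) (rule continuous_on_subset[OF cont], auto)
  then show ?thesis by (simp cong: measurable_cong_sets sets_restrict_space_cong)
qed

lemma l_cont_fst: "0 \<le> t \<Longrightarrow> continuous_on UNIV (\<lambda>x. l x t)"
  using continuous_on_compose2[OF l_cont, of UNIV "\<lambda>x. (x, t)"] continuous_on_Pair[OF continuous_on_id continuous_on_const, of UNIV t]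
  by auto

lemma measurable_l: "0 \<le> t \<Longrightarrow> (\<lambda>x. l x t) \<in> borel_measurable borel"
  by (rule borel_measurable_continuous_onI[OF l_cont_fst])

lemma occupation_formula:
  assumes "0 \<le> t" and A: "A \<in> sets borel"
  shows "(\<integral>\<^sup>+s. indicator A (b s) * indicator {0..t} s \<partial>lborel) = (\<integral>\<^sup>+x. ennreal (l x t) * indicator A x \<partial>lborel)"
proof -
  have "(\<integral>\<^sup>+s. indicator A (b s) * indicator {0..t} s \<partial>lborel) = (\<integral>\<^sup>+s. indicator A (b s) \<partial>restrict_space lborel {0..t})"
    by (rule nn_integral_restrict_space[symmetric]) auto
  also have "\<dots> = (\<integral>\<^sup>+x. indicator A x \<partial>distr (restrict_space lborel {0..t}) lborel b)"
    using borel_b A by (subst nn_integral_distr) auto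
  also have "\<dots> = (\<integral>\<^sup>+x. ennreal (l x t) * indicator A x \<partial>lborel)"
    unfolding l_density[OF \<open>0 \<le> t\<close>] using A measurable_l[OF \<open>0 \<le> t\<close>]
    by (subst nn_integral_density) auto
  finally show ?thesis .
qed

text \<open>The time spent near \<open>x\<close> is a functional of the path alone. Divided by the length of the window it tends
to the local time, which transfers measurability and monotonicity from the path to the local time.\<close>

definition near_time :: "real \<Rightarrow> real \<Rightarrow> real \<Rightarrow> ennreal" where
  "near_time r x t = (\<integral>\<^sup>+s. indicator {y. \<bar>y\<bar> < r} (b s - x) * indicator {0..t} s \<partial>lborel)"

lemma near_time_eq:
  assumes "0 \<le> t"
  shows "near_time r x t = (\<integral>\<^sup>+y. ennreal (l y t) * indicator {x - r<..<x + r} y \<partial>lborel)"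
proof -
  have "near_time r x t = (\<integral>\<^sup>+s. indicator {x - r<..<x + r} (b s) * indicator {0..t} s \<partial>lborel)"
    unfolding near_time_def by (intro nn_integral_cong) (auto simp: indicator_def)
  also have "\<dots> = (\<integral>\<^sup>+y. ennreal (l y t) * indicator {x - r<..<x + r} y \<partial>lborel)"
    by (rule occupation_formula[OF assms]) auto
  finally show ?thesis .
qed

lemma near_time_tendsto:
  assumes "0 \<le> t"
  shows "(\<lambda>j. ennreal (real (Suc j) / 2) * near_time (1 / real (Suc j)) x t) \<longlonglongrightarrow> ennreal (l x t)"
proof -
  let ?r = "\<lambda>j. 1 / real (Suc j)"
  have near_le: "near_time r x t \<le> ennreal t" for r
  proof -
    have "near_time r x t \<le> (\<integral>\<^sup>+s. indicator {0..t} s \<partial>lborel)"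
      unfolding near_time_def by (intro nn_integral_mono) (auto simp: indicator_def)
    then show ?thesis using assms by simp
  qed
  define f where "f j = enn2real (near_time (?r j) x t)" for j
  have f: "near_time (?r j) x t = ennreal (f j)" for j
    unfolding f_def using le_less_trans[OF near_le[of "?r j"] ennreal_less_top] by simp
  have f0: "0 \<le> f j" for j by (simp add: f_def)
  have "(\<lambda>j. real (Suc j) / 2 * f j) \<longlonglongrightarrow> l x t"
  proof (rule metric_LIMSEQ_I)
    fix e :: real assume "0 < e"
    have "isCont (\<lambda>x. l x t) x" using l_cont_fst[OF assms] by (simp add: continuous_on_eq_continuous_at)
    then have "\<exists>d>0. \<forall>y. dist y x < d \<longrightarrow> dist (l y t) (l x t) < e / 2"
      using \<open>0 < e\<close> unfolding continuous_at_eps_delta by (elim allE[of _ "e / 2"]) auto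
    then obtain d where "0 < d" and d: "\<And>y. dist y x < d \<Longrightarrow> dist (l y t) (l x t) < e / 2"
      by blast
    obtain N :: nat where N: "1 / d < real N" using reals_Archimedean2 by blast
    have "dist (real (Suc j) / 2 * f j) (l x t) < e" if "N \<le> j" for j
    proof -
      have "?r j < d"
      proof -
        have "1 / d < real (Suc j)" using N that by linarith
        then show ?thesis using \<open>0 < d\<close> by (simp add: field_simps)
      qed
      then have yd: "l y t \<le> l x t + e / 2 \<and> l x t - e / 2 \<le> l y t" if "y \<in> {x - ?r j<..<x + ?r j}" for y
      proof -
        have "dist y x < ?r j" using that by (auto simp: dist_real_def)
        then have "dist (l y t) (l x t) < e / 2" using d \<open>?r j < d\<close> by (meson less_trans)
        then show ?thesis unfolding dist_real_def by linarith
      qed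
      have "ennreal (f j) \<le> (\<integral>\<^sup>+y. ennreal (l x t + e / 2) * indicator {x - ?r j<..<x + ?r j} y \<partial>lborel)"
        unfolding f[symmetric] near_time_eq[OF assms]
      proof (intro nn_integral_mono)
        fix y
        show "ennreal (l y t) * indicator {x - ?r j<..<x + ?r j} y \<le> ennreal (l x t + e / 2) * indicator {x - ?r j<..<x + ?r j} y"
          using yd[of y] by (auto simp: indicator_def intro!: ennreal_leI)
      qed
      also have "\<dots> = ennreal ((l x t + e / 2) * (2 * ?r j))"
        using l_nonneg[OF assms, of x] \<open>0 < e\<close>
        by (simp add: nn_integral_cmult_indicator ennreal_mult'[symmetric] del: ennreal_plus)
      finally have up: "f j \<le> (l x t + e / 2) * (2 * ?r j)"
        using l_nonneg[OF assms, of x] \<open>0 < e\<close> by (subst (asm) ennreal_le_iff) auto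
      have lo: "(l x t - e / 2) * (2 * ?r j) \<le> f j"
      proof (cases "l x t - e / 2 \<le> 0")
        case True
        then show ?thesis using f0[of j] mult_nonpos_nonneg[of "l x t - e / 2" "2 * ?r j"] by simp
      next
        case False
        have "ennreal ((l x t - e / 2) * (2 * ?r j)) = (\<integral>\<^sup>+y. ennreal (l x t - e / 2) * indicator {x - ?r j<..<x + ?r j} y \<partial>lborel)"
          using False by (simp add: nn_integral_cmult_indicator ennreal_mult'[symmetric])
        also have "\<dots> \<le> ennreal (f j)"
          unfolding f[symmetric] near_time_eq[OF assms]
        proof (intro nn_integral_mono)
          fix y
          show "ennreal (l x t - e / 2) * indicator {x - ?r j<..<x + ?r j} y \<le> ennreal (l y t) * indicator {x - ?r j<..<x + ?r j} y"
            using yd[of y] by (auto simp: indicator_def intro!: ennreal_leI)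
        qed
        finally show ?thesis using f0[of j] by simp
      qed
      have "real (Suc j) / 2 * f j \<le> real (Suc j) / 2 * ((l x t + e / 2) * (2 * ?r j))"
        using up by (rule mult_left_mono) simp
      moreover have "real (Suc j) / 2 * ((l x t - e / 2) * (2 * ?r j)) \<le> real (Suc j) / 2 * f j"
        using lo by (rule mult_left_mono) simp
      ultimately show ?thesis using \<open>0 < e\<close> by (simp add: dist_real_def abs_if del: of_nat_Suc)
    qed
    then show "\<exists>N. \<forall>j\<ge>N. dist (real (Suc j) / 2 * f j) (l x t) < e" by blast
  qed
  then have "(\<lambda>j. ennreal (real (Suc j) / 2 * f j)) \<longlonglongrightarrow> ennreal (l x t)"
    by (rule tendsto_ennrealI)
  moreover have "ennreal (real (Suc j) / 2 * f j) = ennreal (real (Suc j) / 2) * ennreal (f j)" for j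
    by (rule ennreal_mult) (auto simp: f0)
  ultimately show ?thesis unfolding f by simp
qed

lemma l_mono:
  assumes "0 \<le> s" "s \<le> t"
  shows "l x s \<le> l x t"
proof -
  have "ennreal (real (Suc j) / 2) * near_time (1 / real (Suc j)) x s
     \<le> ennreal (real (Suc j) / 2) * near_time (1 / real (Suc j)) x t" for j
    unfolding near_time_def using assms
    by (intro mult_left_mono nn_integral_mono) (auto simp: indicator_def)
  then have "ennreal (l x s) \<le> ennreal (l x t)"
    using assms by (intro LIMSEQ_le[OF near_time_tendsto near_time_tendsto]) auto
  then show ?thesis using assms l_nonneg[of t x] by simp
qed

lemma hits_before:
  assumes "0 \<le> t" "1 \<le> \<bar>b t\<bar>"
  shows "\<exists>s. 0 \<le> s \<and> s \<le> t \<and> \<bar>b s\<bar> = 1"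
proof -
  have "continuous_on {0..t} (\<lambda>s. \<bar>b s\<bar>)"
    by (intro continuous_on_rabs continuous_on_subset[OF cont]) auto
  then show ?thesis using IVT'[of "\<lambda>s. \<bar>b s\<bar>" 0 1 t] assms start by auto
qed

lemma exit_props:
  shows exit_pos: "0 < exit" and abs_exit: "\<bar>b exit\<bar> = 1"
    and exit_le: "\<And>t. 0 \<le> t \<Longrightarrow> 1 \<le> \<bar>b t\<bar> \<Longrightarrow> exit \<le> t"
    and abs_before_exit: "\<And>s. 0 \<le> s \<Longrightarrow> s \<le> exit \<Longrightarrow> \<bar>b s\<bar> \<le> 1"
    and exit_less: "\<And>t. exit < t \<Longrightarrow> \<exists>s. 0 \<le> s \<and> s < t \<and> \<bar>b s\<bar> = 1"
proof -
  let ?H = "{t. 0 \<le> t \<and> \<bar>b t\<bar> = 1}"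
  have ne: "?H \<noteq> {}" using leaves hits_before by blast
  have bdd: "bdd_below ?H" by (rule bdd_belowI[of _ 0]) auto
  have "closed ({0..} \<inter> (\<lambda>t. \<bar>b t\<bar>) -` {1})"
    by (rule continuous_closed_preimage) (auto intro!: continuous_on_rabs cont)
  moreover have "{0..} \<inter> (\<lambda>t. \<bar>b t\<bar>) -` {1} = ?H" by auto
  ultimately have "closed ?H" by simp
  from closed_contains_Inf[OF ne bdd this] have e: "0 \<le> exit" "\<bar>b exit\<bar> = 1"
    by (auto simp: exit_def)
  show "\<bar>b exit\<bar> = 1" by fact
  show "0 < exit" using e start by (cases "exit = 0") auto
  show le: "exit \<le> t" if "0 \<le> t" "1 \<le> \<bar>b t\<bar>" for t
  proof -
    from hits_before[OF that] obtain s where "0 \<le> s" "s \<le> t" "\<bar>b s\<bar> = 1" by blast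
    then have "exit \<le> s" unfolding exit_def by (intro cInf_lower bdd) auto
    with \<open>s \<le> t\<close> show ?thesis by simp
  qed
  show "\<bar>b s\<bar> \<le> 1" if "0 \<le> s" "s \<le> exit" for s
    using le[of s] that e by (cases "s = exit"; cases "1 \<le> \<bar>b s\<bar>") auto
  show "\<exists>s. 0 \<le> s \<and> s < t \<and> \<bar>b s\<bar> = 1" if "exit < t" for t
    using e that by (intro exI[of _ exit]) auto
qed

text \<open>A description of the exit time by countably many path values. The level is only approached, not
reached, at rational times.\<close>

lemma exit_le_iff_rationals:
  assumes "0 \<le> t"
  shows "exit \<le> t \<longleftrightarrow> (\<forall>k::nat. \<exists>r\<in>\<rat>. 0 \<le> r \<and> r \<le> t \<and> 1 - 1 / real (Suc k) < \<bar>b r\<bar>)"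
proof
  assume "exit \<le> t"
  show "\<forall>k::nat. \<exists>r\<in>\<rat>. 0 \<le> r \<and> r \<le> t \<and> 1 - 1 / real (Suc k) < \<bar>b r\<bar>"
  proof
    fix k :: nat
    have "continuous (at exit within {0..}) b" using cont exit_pos by (auto simp: continuous_on_eq_continuous_within)
    then have "\<exists>d>0. \<forall>x\<in>{0..}. dist x exit < d \<longrightarrow> dist (b x) (b exit) < 1 / real (Suc k)"
      unfolding continuous_within_eps_delta by (auto simp: dist_commute)
    then obtain d where d: "0 < d" "\<And>x. 0 \<le> x \<Longrightarrow> dist x exit < d \<Longrightarrow> dist (b x) (b exit) < 1 / real (Suc k)"
      by auto
    obtain r where r: "r \<in> \<rat>" "max 0 (exit - d) < r" "r < exit"
      using Rats_dense_in_real[of "max 0 (exit - d)" exit] exit_pos d(1) by auto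
    have "dist (b r) (b exit) < 1 / real (Suc k)" using d(2)[of r] r by (auto simp: dist_real_def)
    then have "1 - 1 / real (Suc k) < \<bar>b r\<bar>" using abs_exit by (auto simp: dist_real_def abs_if split: if_splits)
    then show "\<exists>r\<in>\<rat>. 0 \<le> r \<and> r \<le> t \<and> 1 - 1 / real (Suc k) < \<bar>b r\<bar>"
      using r \<open>exit \<le> t\<close> by (intro bexI[of _ r]) auto
  qed
next
  assume *: "\<forall>k::nat. \<exists>r\<in>\<rat>. 0 \<le> r \<and> r \<le> t \<and> 1 - 1 / real (Suc k) < \<bar>b r\<bar>"
  have "continuous_on {0..t} (\<lambda>s. \<bar>b s\<bar>)"
    by (intro continuous_on_rabs continuous_on_subset[OF cont]) auto
  then obtain s where s: "s \<in> {0..t}" "\<And>r. r \<in> {0..t} \<Longrightarrow> \<bar>b r\<bar> \<le> \<bar>b s\<bar>"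
    using continuous_attains_sup[of "{0..t}" "\<lambda>s. \<bar>b s\<bar>"] assms by auto
  have "1 \<le> \<bar>b s\<bar>"
  proof (rule LIMSEQ_le_const2)
    show "(\<lambda>k. 1 - 1 / real (Suc k)) \<longlonglongrightarrow> 1"
      using tendsto_diff[OF tendsto_const LIMSEQ_inverse_real_of_nat, of "1::real"] by (simp add: inverse_eq_divide)
    have "1 - 1 / real (Suc k) \<le> \<bar>b s\<bar>" for k
    proof -
      obtain r where "0 \<le> r" "r \<le> t" "1 - 1 / real (Suc k) < \<bar>b r\<bar>" using * by blast
      with s(2)[of r] show ?thesis by simp
    qed
    then show "\<exists>N. \<forall>k\<ge>N. 1 - 1 / real (Suc k) \<le> \<bar>b s\<bar>" by blast
  qed
  then show "exit \<le> t" using exit_le[of s] s by auto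
qed

end

section \<open>Two inequalities for real powers\<close>

text \<open>The graph of the \<open>q\<close>-th power lies above its tangent at \<open>a\<close>.\<close>

lemma powr_tangent_le:
  fixes u a q :: real
  assumes "1 \<le> q" "0 < a" "0 \<le> u"
  shows "u \<le> (1 - 1/q) * a + a powr (1 - q) / q * u powr q"
proof -
  have *: "1 + q * (v - 1) \<le> v powr q" if "0 \<le> v" for v :: real
  proof (cases "v = 0")
    case True
    then show ?thesis using assms by simp
  next
    case False
    then have v: "0 < v" using that by simp
    have "v - 1 \<le> (v powr q - 1) / q"
    proof -
      define F where "F x = x powr q - q * x" for x :: real
      have der: "(F has_real_derivative q * x powr (q - 1) - q) (at x)" if "0 < x" for x
        unfolding F_def using that by (auto intro!: derivative_eq_intros)
      have "F 1 \<le> F v"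
      proof (cases "1 \<le> v")
        case True
        show ?thesis
        proof (rule DERIV_nonneg_imp_nondecreasing[OF True])
          fix x :: real assume x: "1 \<le> x" "x \<le> v"
          have "1 \<le> x powr (q - 1)" using x assms by (intro ge_one_powr_ge_zero) auto
          then show "\<exists>y. (F has_real_derivative y) (at x) \<and> 0 \<le> y"
            using der[of x] x assms by (intro exI[of _ "q * x powr (q - 1) - q"]) auto
        qed
      next
        case False
        then have "v \<le> 1" by simp
        then show ?thesis
        proof (rule DERIV_nonpos_imp_nonincreasing)
          fix x :: real assume x: "v \<le> x" "x \<le> 1"
          have "x powr (q - 1) \<le> 1" using x v assms by (intro powr_le1) auto
          then show "\<exists>y. (F has_real_derivative y) (at x) \<and> y \<le> 0"
            using der[of x] x v assms by (intro exI[of _ "q * x powr (q - 1) - q"]) auto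
        qed
      qed
      then show ?thesis using assms by (simp add: F_def field_simps)
    qed
    then show ?thesis using assms by (simp add: field_simps)
  qed
  have "1 + q * (u / a - 1) \<le> u powr q / a powr q"
    using *[of "u / a"] assms by (simp add: powr_divide)
  then have "a / q * (1 + q * (u / a - 1)) \<le> a / q * (u powr q / a powr q)"
    using assms by (intro mult_left_mono) auto
  moreover have "a / q * (1 + q * (u / a - 1)) = u - (1 - 1/q) * a"
    using assms by (simp add: field_simps)
  moreover have "a / q * (u powr q / a powr q) = a powr (1 - q) / q * u powr q"
    using assms by (simp add: powr_diff)
  ultimately show ?thesis by simp
qed

text \<open>Below \<open>a\<close> the linear term dominates the \<open>q\<close>-th power, above \<open>a\<close> the \<open>m\<close>-th power does.\<close>

lemma powr_interpolation:
  fixes u a q :: real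
  assumes "1 \<le> q" "q \<le> real m" "0 < a" "0 \<le> u"
  shows "u powr q \<le> a powr (q - 1) * u + a powr (q - real m) * u ^ m"
proof (cases "u = 0")
  case True
  then show ?thesis using assms by (cases m) auto
next
  case False
  then have u: "0 < u" using assms by simp
  have 1: "u powr q = u powr (q - 1) * u" using u by (simp add: powr_diff)
  have 2: "u powr q = u powr (q - real m) * u ^ m" using u by (simp add: powr_diff powr_realpow)
  show ?thesis
  proof (cases "u \<le> a")
    case True
    then have "u powr (q - 1) \<le> a powr (q - 1)" using assms by (intro powr_mono2) auto
    then have "u powr q \<le> a powr (q - 1) * u" unfolding 1 using u by (intro mult_right_mono) auto
    then show ?thesis using u assms by (smt (verit) mult_nonneg_nonneg powr_ge_zero zero_le_power)
  next
    case False
    then have "u powr (q - real m) \<le> a powr (q - real m)" using assms by (intro powr_mono2') auto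
    then have "u powr q \<le> a powr (q - real m) * u ^ m" unfolding 2 using u by (intro mult_right_mono) auto
    then show ?thesis using u assms by (smt (verit) mult_nonneg_nonneg powr_ge_zero zero_le_power)
  qed
qed

section \<open>Power integrals of the local time at the exit time\<close>

text \<open>Finiteness of the limit matters: multiplication of extended reals is discontinuous where 0 meets infinity.\<close>

lemma ennreal_tendsto_power:
  assumes "(f \<longlongrightarrow> ennreal c) F"
  shows "((\<lambda>x. f x ^ m) \<longlongrightarrow> ennreal c ^ m) F"
proof (induction m)
  case (Suc m)
  have "ennreal c ^ m \<noteq> \<top>" by (simp add: power_eq_top_ennreal)
  then show ?case
    using tendsto_mult_ennreal[OF assms Suc] by simp
qed simp

context local_time_path
begin

lemma nn_integral_l:
  assumes "0 \<le> t"
  shows "(\<integral>\<^sup>+x. ennreal (l x t) \<partial>lborel) = ennreal t"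
  using occupation_formula[OF assms, of UNIV] assms by simp

lemma nn_integral_l_exit:
  "(\<integral>\<^sup>+x. ennreal (l x exit) * indicator {-1..1} x \<partial>lborel) = ennreal exit"
proof -
  have e: "0 \<le> exit" using exit_pos by simp
  have "(\<integral>\<^sup>+x. ennreal (l x exit) * indicator {-1..1} x \<partial>lborel)
      = (\<integral>\<^sup>+s. indicator {-1..1} (b s) * indicator {0..exit} s \<partial>lborel)"
    by (rule occupation_formula[OF e, symmetric]) auto
  also have "\<dots> = (\<integral>\<^sup>+s. indicator {0..exit} s \<partial>lborel)"
    using abs_before_exit by (intro nn_integral_cong) (auto simp: indicator_def abs_le_iff)
  finally show ?thesis using e by simp
qed

text \<open>The tangent inequality at \<open>a = \<epsilon> powr (1/q)\<close>, integrated over \<open>[-1, 1]\<close>. It gives the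
bound \<open>(2 - 1/q) a\<close>; a constant larger than 2 would lead to times beyond the range in which twice the
Gaussian tail is below 1.\<close>

lemma exit_less_of_small_power_integral:
  assumes q: "1 \<le> q" and \<epsilon>: "0 < \<epsilon>"
    and small: "(\<integral>\<^sup>+x. ennreal (l x exit powr q) \<partial>lborel) < ennreal \<epsilon>"
  shows "exit < 2 * \<epsilon> powr (1 / q)"
proof -
  define a where "a = \<epsilon> powr (1 / q)"
  have a: "0 < a" using \<epsilon> by (simp add: a_def)
  have aq: "a powr (1 - q) * \<epsilon> = a"
  proof -
    have "a powr (1 - q) * \<epsilon> = \<epsilon> powr ((1 / q) * (1 - q)) * \<epsilon> powr 1"
      using \<epsilon> by (simp add: a_def powr_powr)
    also have "\<dots> = \<epsilon> powr ((1 / q) * (1 - q) + 1)" by (rule powr_add[symmetric])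
    also have "(1 / q) * (1 - q) + 1 = 1 / q" using q by (simp add: field_simps)
    finally show ?thesis by (simp add: a_def)
  qed
  have e: "0 \<le> exit" using exit_pos by simp
  note [measurable] = measurable_l[OF e]
  define c where "c = (1 - 1/q) * a"
  define d where "d = a powr (1 - q) / q"
  have c: "0 \<le> c" and d: "0 < d" using q a by (auto simp: c_def d_def)
  obtain I where I: "(\<integral>\<^sup>+x. ennreal (l x exit powr q) \<partial>lborel) = ennreal I" "0 \<le> I"
    using small by (cases "\<integral>\<^sup>+x. ennreal (l x exit powr q) \<partial>lborel") auto
  have "ennreal exit \<le> (\<integral>\<^sup>+x. ennreal c * indicator {-1..1} x + ennreal d * ennreal (l x exit powr q) \<partial>lborel)"
    unfolding nn_integral_l_exit[symmetric]
  proof (intro nn_integral_mono)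
    fix x
    have "ennreal (l x exit) \<le> ennreal (c + d * l x exit powr q)"
      unfolding c_def d_def by (intro ennreal_leI powr_tangent_le q a l_nonneg e)
    also have "\<dots> = ennreal c + ennreal d * ennreal (l x exit powr q)"
      using c d by (simp add: ennreal_mult')
    finally show "ennreal (l x exit) * indicator {-1..1} x \<le> ennreal c * indicator {-1..1} x + ennreal d * ennreal (l x exit powr q)"
      by (auto simp: indicator_def)
  qed
  also have "\<dots> = ennreal c * 2 + ennreal d * ennreal I"
    by (subst nn_integral_add) (auto simp: nn_integral_cmult nn_integral_cmult_indicator I)
  also have "\<dots> = ennreal (c * 2 + d * I)"
    using c d I by (simp add: ennreal_mult)
  finally have "exit \<le> c * 2 + d * I"
    using c d I by (subst (asm) ennreal_le_iff) auto
  also have "\<dots> < c * 2 + d * \<epsilon>"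
    using small d I by (simp add: ennreal_less_iff)
  also have "d * \<epsilon> = a / q" using aq by (simp add: d_def)
  also have "c * 2 + a / q = 2 * a - a / q" using q by (simp add: c_def field_simps)
  also have "\<dots> \<le> 2 * a" using a q by simp
  finally show ?thesis unfolding a_def by simp
qed

text \<open>Monotonicity in time passes from the exit time to the deterministic time \<open>T\<close>; the total mass of the
local time at \<open>T\<close> is \<open>T\<close>.\<close>

lemma power_integral_exit_le:
  assumes q: "1 \<le> q" "q \<le> real m" and a: "0 < a" and T: "exit \<le> T"
  shows "(\<integral>\<^sup>+x. ennreal (l x exit powr q) \<partial>lborel)
    \<le> ennreal (a powr (q - 1) * T) + ennreal (a powr (q - real m)) * (\<integral>\<^sup>+x. ennreal (l x T) ^ m \<partial>lborel)"
proof -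
  have e: "0 \<le> exit" and T0: "0 \<le> T" using exit_pos T by simp_all
  note [measurable] = measurable_l[OF T0]
  have "(\<integral>\<^sup>+x. ennreal (l x exit powr q) \<partial>lborel)
    \<le> (\<integral>\<^sup>+x. ennreal (a powr (q - 1)) * ennreal (l x T) + ennreal (a powr (q - real m)) * ennreal (l x T) ^ m \<partial>lborel)"
  proof (intro nn_integral_mono)
    fix x
    have "l x exit powr q \<le> l x T powr q"
      using q T e by (intro powr_mono2 l_mono l_nonneg) auto
    also have "\<dots> \<le> a powr (q - 1) * l x T + a powr (q - real m) * l x T ^ m"
      by (intro powr_interpolation q a l_nonneg T0)
    finally have "ennreal (l x exit powr q) \<le> ennreal \<dots>" by (rule ennreal_leI)
    also have "\<dots> = ennreal (a powr (q - 1)) * ennreal (l x T) + ennreal (a powr (q - real m)) * ennreal (l x T) ^ m"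
      using l_nonneg[OF T0] by (simp add: ennreal_mult' ennreal_power)
    finally show "ennreal (l x exit powr q) \<le> \<dots>" .
  qed
  also have "\<dots> = ennreal (a powr (q - 1)) * ennreal T + ennreal (a powr (q - real m)) * (\<integral>\<^sup>+x. ennreal (l x T) ^ m \<partial>lborel)"
    by (subst nn_integral_add) (auto simp: nn_integral_cmult nn_integral_l[OF T0])
  finally show ?thesis by (simp add: ennreal_mult')
qed

text \<open>The level 99/100 instead of 1 makes up for the path reaching 1 between grid points.\<close>

lemma exit_less_imp_grid_large:
  assumes "exit < t"
  shows "\<forall>\<^sub>F n in sequentially. \<exists>k\<le>n. 99/100 \<le> \<bar>b (real k * (t / real n))\<bar>"
proof -
  obtain s where s: "0 \<le> s" "s < t" "\<bar>b s\<bar> = 1" using exit_less[OF assms] by blast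
  have t: "0 < t" using s by simp
  have "continuous (at s within {0..}) b" using cont s by (auto simp: continuous_on_eq_continuous_within)
  then have "\<exists>d>0. \<forall>x\<in>{0..}. dist x s < d \<longrightarrow> dist (b x) (b s) < 1/100"
    unfolding continuous_within_eps_delta by (elim allE[of _ "1/100"]) auto
  then obtain d where d: "0 < d" "\<And>x. 0 \<le> x \<Longrightarrow> dist x s < d \<Longrightarrow> dist (b x) (b s) < 1/100"
    by auto
  obtain N :: nat where N: "t / d < real N" using reals_Archimedean2 by blast
  have "\<exists>k\<le>n. 99/100 \<le> \<bar>b (real k * (t / real n))\<bar>" if "max 1 N \<le> n" for n
  proof -
    have n: "0 < real n" "t / d < real n" using N that by auto
    then have hd: "t / real n < d" using d(1) by (simp add: field_simps)
    let ?k = "nat \<lfloor>s * real n / t\<rfloor>"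
    have kf: "real ?k = of_int \<lfloor>s * real n / t\<rfloor>" using s n t by simp
    have k1: "real ?k \<le> s * real n / t" "s * real n / t < real ?k + 1"
      unfolding kf by linarith+
    have "s * real n / t \<le> real n" using s t n by (simp add: field_simps mult_left_mono)
    then have "?k \<le> n" using k1(1) by linarith
    moreover have le: "real ?k * (t / real n) \<le> s" using k1(1) n t by (simp add: field_simps)
    moreover have "s < real ?k * (t / real n) + t / real n" using k1(2) n t by (simp add: field_simps)
    ultimately have "dist (real ?k * (t / real n)) s < d" using hd by (auto simp: dist_real_def)
    then have "dist (b (real ?k * (t / real n))) (b s) < 1/100"
      using t n by (intro d(2)) auto
    then have "99/100 \<le> \<bar>b (real ?k * (t / real n))\<bar>"
      using s(3) unfolding dist_real_def by linarith
    with \<open>?k \<le> n\<close> show ?thesis by blast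
  qed
  then show ?thesis unfolding eventually_sequentially by blast
qed

text \<open>By uniform continuity the path moves by less than \<open>r\<close> within one grid cell once the grid is fine, so
doubling the window makes the count of grid points dominate the time spent, for all \<open>x\<close> at once.\<close>

lemma near_time_le_grid_count:
  assumes "0 < T" "0 < r"
  shows "\<forall>\<^sub>F n in sequentially. \<forall>x. near_time r x T
    \<le> ennreal (T / real n) * (\<Sum>k<n. indicator {y. \<bar>y\<bar> < 2 * r} (b (real k * (T / real n)) - x))"
proof -
  have "uniformly_continuous_on {0..T} b"
    by (intro compact_uniformly_continuous continuous_on_subset[OF cont]) auto
  then obtain d where d: "0 < d" "\<And>u v. u \<in> {0..T} \<Longrightarrow> v \<in> {0..T} \<Longrightarrow> dist v u < d \<Longrightarrow> dist (b v) (b u) < r"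
    using \<open>0 < r\<close> unfolding uniformly_continuous_on_def by metis
  obtain N :: nat where N: "T / d < real N" using reals_Archimedean2 by blast
  have "near_time r x T \<le> ennreal (T / real n) * (\<Sum>k<n. indicator {y. \<bar>y\<bar> < 2 * r} (b (real k * (T / real n)) - x))"
    if "max 1 N \<le> n" for n x
  proof -
    have n: "0 < real n" "T / d < real n" using N that by auto
    then have hd: "T / real n < d" using d(1) by (simp add: field_simps)
    let ?h = "T / real n"
    have h: "0 < ?h" using n assms by simp
    let ?J = "\<lambda>k. {real k * ?h..real k * ?h + ?h}"
    let ?c = "\<lambda>k. indicator {y. \<bar>y\<bar> < 2 * r} (b (real k * ?h) - x) :: ennreal"
    have "near_time r x T \<le> (\<integral>\<^sup>+s. (\<Sum>k<n. ?c k * indicator (?J k) s) \<partial>lborel)"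
      unfolding near_time_def
    proof (rule nn_integral_mono_AE)
      have "AE s in lborel. s \<noteq> T" by (rule AE_lborel_singleton)
      then show "AE s in lborel. indicator {y. \<bar>y\<bar> < r} (b s - x) * indicator {0..T} s \<le> (\<Sum>k<n. ?c k * indicator (?J k) s)"
      proof eventually_elim
        case (elim s)
        show ?case
        proof (cases "\<bar>b s - x\<bar> < r \<and> s \<in> {0..T}")
          case True
          let ?k = "nat \<lfloor>s * real n / T\<rfloor>"
          have s: "0 \<le> s" "s < T" using True elim by auto
          have kf: "real ?k = of_int \<lfloor>s * real n / T\<rfloor>" using s n assms by simp
          have k1: "real ?k \<le> s * real n / T" "s * real n / T < real ?k + 1"
            unfolding kf by linarith+
          have "s * real n / T < real n" using s assms n by (simp add: field_simps)
          then have kn: "?k < n" using k1(1) by linarith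
          have le: "real ?k * ?h \<le> s" "s < real ?k * ?h + ?h"
            using k1 n assms by (simp_all add: field_simps)
          have "dist (b s) (b (real ?k * ?h)) < r"
            using le hd s h by (intro d(2)) (auto simp: dist_real_def)
          then have c: "?c ?k = 1" using True unfolding dist_real_def by (auto simp: indicator_def)
          have "indicator {y. \<bar>y\<bar> < r} (b s - x) * indicator {0..T} s \<le> ?c ?k * indicator (?J ?k) s"
            using le c by (auto simp: indicator_def)
          also have "\<dots> \<le> (\<Sum>k<n. ?c k * indicator (?J k) s)"
            by (rule member_le_sum[of ?k "{..<n}" "\<lambda>k. ?c k * indicator (?J k) s"]) (use kn in auto)
          finally show ?thesis .
        qed (auto simp: indicator_def)
      qed
    qed
    also have "\<dots> = (\<Sum>k<n. ?c k * ennreal ?h)"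
      using h by (subst nn_integral_sum) (auto simp: nn_integral_cmult)
    also have "\<dots> = ennreal ?h * (\<Sum>k<n. ?c k)" by (simp add: sum_distrib_left mult.commute)
    finally show ?thesis .
  qed
  then show ?thesis unfolding eventually_sequentially by blast
qed

text \<open>Fatou's lemma for the shrinking spatial window, preceded by the comparison with the grid count for each
fixed window. The window doubling costs only a constant factor.\<close>

lemma power_integral_le_liminf_grid:
  assumes "0 < T"
  shows "(\<integral>\<^sup>+x. ennreal (l x T) ^ m \<partial>lborel) \<le> liminf (\<lambda>j. liminf (\<lambda>n.
     \<integral>\<^sup>+x. (ennreal (real (Suc j) / 2) * (ennreal (T / real n) *
       (\<Sum>k<n. indicator {y. \<bar>y\<bar> < 2 * (1 / real (Suc j))} (b (real k * (T / real n)) - x)))) ^ m \<partial>lborel))"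
proof -
  have T: "0 \<le> T" using assms by simp
  let ?u = "\<lambda>j x. ennreal (real (Suc j) / 2) * near_time (1 / real (Suc j)) x T"
  let ?v = "\<lambda>j n x. ennreal (real (Suc j) / 2) * (ennreal (T / real n) *
       (\<Sum>k<n. indicator {y. \<bar>y\<bar> < 2 * (1 / real (Suc j))} (b (real k * (T / real n)) - x)))"
  have [measurable]: "(\<lambda>x. near_time r x T) \<in> borel_measurable borel" for r
  proof -
    have [measurable]: "(\<lambda>x. l x T) \<in> borel_measurable borel" by (rule measurable_l[OF T])
    have "near_time r x T = (\<integral>\<^sup>+y. ennreal (l y T) * (if \<bar>y - x\<bar> < r then 1 else 0) \<partial>lborel)" for x
      unfolding near_time_eq[OF T] by (intro nn_integral_cong) (auto simp: indicator_def)
    then show ?thesis by simp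
  qed
  have "(\<integral>\<^sup>+x. ennreal (l x T) ^ m \<partial>lborel) = (\<integral>\<^sup>+x. liminf (\<lambda>j. ?u j x ^ m) \<partial>lborel)"
  proof (intro nn_integral_cong)
    fix x
    have "(\<lambda>j. ?u j x ^ m) \<longlonglongrightarrow> ennreal (l x T) ^ m"
      by (intro ennreal_tendsto_power near_time_tendsto T)
    then show "ennreal (l x T) ^ m = liminf (\<lambda>j. ?u j x ^ m)"
      by (intro lim_imp_Liminf[symmetric]) auto
  qed
  also have "\<dots> \<le> liminf (\<lambda>j. \<integral>\<^sup>+x. ?u j x ^ m \<partial>lborel)"
    by (rule nn_integral_liminf) measurable
  also have "\<dots> \<le> liminf (\<lambda>j. liminf (\<lambda>n. \<integral>\<^sup>+x. ?v j n x ^ m \<partial>lborel))"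
  proof (rule Liminf_mono[OF always_eventually], rule allI, rule Liminf_bounded)
    fix j
    have "\<forall>\<^sub>F n in sequentially. \<forall>x. near_time (1 / real (Suc j)) x T \<le> ennreal (T / real n) *
       (\<Sum>k<n. indicator {y. \<bar>y\<bar> < 2 * (1 / real (Suc j))} (b (real k * (T / real n)) - x))"
      using assms by (intro near_time_le_grid_count) auto
    then show "\<forall>\<^sub>F n in sequentially. (\<integral>\<^sup>+x. ?u j x ^ m \<partial>lborel) \<le> (\<integral>\<^sup>+x. ?v j n x ^ m \<partial>lborel)"
      by eventually_elim (intro nn_integral_mono power_mono mult_left_mono, auto)
  qed
  finally show ?thesis .
qed

end

section \<open>Almost sure properties of Brownian paths\<close>

context standard_brownian_motion
begin

lemma grid_indep_increments:
  assumes "0 \<le> h"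
  shows "indep_vars (\<lambda>_. borel) (\<lambda>i \<omega>. B (real (Suc i) * h) \<omega> - B (real i * h) \<omega>) {..<n}"
  using assms by (intro indep_increments[of "\<lambda>i. real i * h" n] mult_right_mono) auto

lemma grid_normal_increments:
  assumes "0 < h" "j < l"
  shows "distributed M lborel (\<lambda>\<omega>. B (real l * h) \<omega> - B (real j * h) \<omega>) (normal_density 0 (sqrt (real (l - j) * h)))"
proof -
  have "distributed M lborel (\<lambda>\<omega>. B (real l * h) \<omega> - B (real j * h) \<omega>) (\<lambda>x. ennreal (normal_density 0 (sqrt (real l * h - real j * h)) x))"
    using assms by (intro normal_increments) auto
  then show ?thesis using assms by (simp add: of_nat_diff left_diff_distrib)
qed

text \<open>At time \<open>n\<close> the path is within distance 1 of its start with probability of order \<open>1 / sqrt n\<close> only, so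
almost surely it is not so at every integer time.\<close>

lemma AE_leaves: "AE \<omega> in M. \<exists>t\<ge>0. 1 \<le> \<bar>B t \<omega>\<bar>"
proof -
  note measurable_B[measurable]
  define A where "A = {\<omega>\<in>space M. \<forall>n::nat. \<bar>B (real n) \<omega> - B 0 \<omega>\<bar> < 1}"
  have [measurable]: "A \<in> sets M" unfolding A_def by measurable
  have "prob A \<le> 2 / sqrt (2 * pi * real (Suc n))" for n
  proof -
    have "prob A \<le> prob {\<omega>\<in>space M. \<bar>B (real (Suc n)) \<omega> - B 0 \<omega>\<bar> < 1}"
      unfolding A_def by (intro finite_measure_mono Collect_mono) (blast, measurable)
    also have "\<dots> \<le> 2 * 1 / sqrt (2 * pi * real (Suc n))"
      using grid_normal_increments[of 1 0 "Suc n"] by (intro gaussian_small_prob) auto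
    finally show ?thesis by simp
  qed
  moreover have "(\<lambda>n. 2 / sqrt (2 * pi * real (Suc n))) \<longlonglongrightarrow> 0"
    by (intro real_tendsto_divide_at_top[OF tendsto_const] filterlim_compose[OF sqrt_at_top]
        filterlim_tendsto_pos_mult_at_top[OF tendsto_const] filterlim_compose[OF filterlim_real_sequentially filterlim_Suc]) auto
  ultimately have "prob A \<le> 0" by (intro LIMSEQ_le_const) auto
  then have "prob A = 0" by (simp add: measure_le_0_iff)
  then have "AE \<omega> in M. \<omega> \<notin> A"
    by (intro AE_not_in) (auto simp: null_sets_def emeasure_eq_measure)
  with start_origin AE_space show ?thesis
  proof eventually_elim
    case (elim \<omega>)
    then obtain n :: nat where "1 \<le> \<bar>B (real n) \<omega> - B 0 \<omega>\<bar>" by (auto simp: A_def not_less)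
    then show ?case using elim by (intro exI[of _ "real n"]) auto
  qed
qed

lemma AE_local_time_path:
  assumes "local_time_field M B L"
  shows "AE \<omega> in M. local_time_path (\<lambda>t. B t \<omega>) (\<lambda>x t. L x t \<omega>)"
  using start_origin continuous_paths AE_leaves assms[unfolded local_time_field_def]
proof eventually_elim
  case (elim \<omega>)
  then show ?case
    by unfold_locales (auto simp: occupation_measure_def)
qed

section \<open>Measurability of the event\<close>

text \<open>A version of the process that is jointly measurable in time and chance and agrees with it at all
times on every continuous path.\<close>

definition limit_path :: "real \<Rightarrow> 'a \<Rightarrow> real" where
  "limit_path s \<omega> = lim (\<lambda>n. B (real (nat \<lfloor>s * real (Suc n)\<rfloor>) / real (Suc n)) \<omega>)"

lemma measurable_limit_path[measurable]:
  "(\<lambda>z. limit_path (fst z) (snd z)) \<in> borel_measurable (borel \<Otimes>\<^sub>M completion M)"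
proof -
  have "(\<lambda>z. B (real (nat \<lfloor>fst z * real (Suc n)\<rfloor>) / real (Suc n)) (snd z)) \<in> borel_measurable (borel \<Otimes>\<^sub>M completion M)" for n
  proof (rule measurable_compose_countable[where f="\<lambda>k z. B (real k / real (Suc n)) (snd z)" and g="\<lambda>z. nat \<lfloor>fst z * real (Suc n)\<rfloor>"])
    fix k
    have "B (real k / real (Suc n)) \<in> borel_measurable (completion M)"
      by (intro measurable_completion measurable_B) auto
    then show "(\<lambda>z. B (real k / real (Suc n)) (snd z)) \<in> borel_measurable (borel \<Otimes>\<^sub>M completion M)"
      by measurable
  qed (measurable)
  then show ?thesis unfolding limit_path_def by (rule borel_measurable_lim_metric)
qed

lemma limit_path_eq:
  assumes "continuous_on {0..} (\<lambda>t. B t \<omega>)" "0 \<le> s"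
  shows "limit_path s \<omega> = B s \<omega>"
proof -
  let ?s = "\<lambda>n. real (nat \<lfloor>s * real (Suc n)\<rfloor>) / real (Suc n)"
  have "?s \<longlonglongrightarrow> s"
  proof (rule tendsto_sandwich)
    have fl: "real (nat \<lfloor>s * real (Suc n)\<rfloor>) = of_int \<lfloor>s * real (Suc n)\<rfloor>" for n
      using assms(2) by (intro of_nat_nat) simp
    show "\<forall>\<^sub>F n in sequentially. ?s n \<le> s"
      unfolding fl by (intro always_eventually allI) (simp add: divide_le_eq del: of_nat_Suc)
    show "\<forall>\<^sub>F n in sequentially. s - 1 / real (Suc n) \<le> ?s n"
    proof (intro always_eventually allI)
      fix n
      have "(s * real (Suc n) - 1) / real (Suc n) \<le> ?s n"
        unfolding fl by (intro divide_right_mono) linarith+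
      then show "s - 1 / real (Suc n) \<le> ?s n" by (simp add: diff_divide_distrib del: of_nat_Suc)
    qed
    show "(\<lambda>n. s - 1 / real (Suc n)) \<longlonglongrightarrow> s"
      using tendsto_diff[OF tendsto_const LIMSEQ_inverse_real_of_nat, of s] by (simp add: inverse_eq_divide)
  qed simp
  then have "(\<lambda>n. B (?s n) \<omega>) \<longlonglongrightarrow> B s \<omega>"
    using assms by (intro continuous_on_tendsto_compose[OF assms(1)]) auto
  then show ?thesis unfolding limit_path_def by (rule limI)
qed

lemma exit_time_eq: "exit_time B \<omega> = local_time_path.exit (\<lambda>t. B t \<omega>)"
  if "local_time_path (\<lambda>t. B t \<omega>) l"
  using local_time_path.exit_def[OF that] by (simp add: exit_time_def)

lemma complete_measure_completion: "complete_measure (completion M)"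
  by standard

lemma measurable_exit_time:
  assumes L: "local_time_field M B L"
  shows "exit_time B \<in> borel_measurable (completion M)"
  unfolding borel_measurable_iff_le
proof
  fix a :: real
  define P where "P \<omega> \<longleftrightarrow> 0 \<le> a \<and> (\<forall>k::nat. \<exists>r\<in>{r\<in>\<rat>. 0 \<le> r \<and> r \<le> a}. 1 - 1 / real (Suc k) < \<bar>B r \<omega>\<bar>)" for \<omega>
  have c: "countable {r\<in>\<rat>. 0 \<le> r \<and> r \<le> a}"
    by (rule countable_subset[OF _ countable_rat]) auto
  have "{\<omega>\<in>space M. P \<omega>} \<in> sets M"
    unfolding P_def
  proof (intro sets.sets_Collect_conj sets.sets_Collect_countable_All sets.sets_Collect_countable_Ex' c)
    fix k :: nat and r assume "r \<in> {r\<in>\<rat>. 0 \<le> r \<and> r \<le> a}"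
    then have [measurable]: "B r \<in> borel_measurable M" by (intro measurable_B) auto
    show "{\<omega>\<in>space M. 1 - 1 / real (Suc k) < \<bar>B r \<omega>\<bar>} \<in> sets M" by measurable
  qed auto
  then have P: "{\<omega>\<in>space M. P \<omega>} \<in> sets (completion M)" by simp
  have "AE \<omega> in completion M. \<omega> \<in> {\<omega>\<in>space M. P \<omega>} \<longleftrightarrow> \<omega> \<in> {\<omega>\<in>space (completion M). exit_time B \<omega> \<le> a}"
    using AE_completion[OF AE_local_time_path[OF L]]
  proof eventually_elim
    case (elim \<omega>)
    interpret local_time_path "\<lambda>t. B t \<omega>" "\<lambda>x t. L x t \<omega>" by fact
    show ?case
    proof (cases "0 \<le> a")
      case True
      have "P \<omega> \<longleftrightarrow> exit \<le> a"
        unfolding P_def exit_le_iff_rationals[OF True] using True by (simp only: bex_simps) blast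
      then show ?thesis using exit_time_eq[OF elim] by simp
    next
      case False
      then show ?thesis using exit_time_eq[OF elim] exit_pos by (simp add: P_def)
    qed
  qed
  then show "{\<omega>\<in>space (completion M). exit_time B \<omega> \<le> a} \<in> sets (completion M)"
    by (rule complete_measure.in_sets_AE[OF complete_measure_completion _ P]) auto
qed

text \<open>Outside a null set, the local time at the exit time is determined by the occupation times of the
jointly measurable version of the path, and it inherits their measurability.\<close>

lemma measurable_small_local_time_event:
  assumes L: "local_time_field M B L"
  shows "{\<omega>\<in>space M. (\<integral>\<^sup>+x. ennreal (L x (exit_time B \<omega>) \<omega> powr q) \<partial>lborel) < ennreal \<epsilon>} \<in> sets (completion M)"
proof -
  note measurable_exit_time[OF L, measurable]
  define A where "A r x \<omega> = (\<integral>\<^sup>+s. indicator {y. \<bar>y\<bar> < r} (limit_path s \<omega> - x) * (if 0 \<le> s \<and> s \<le> exit_time B \<omega> then 1 else 0) \<partial>lborel)" for r x \<omega>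
  define F where "F \<omega> = (\<integral>\<^sup>+x. ennreal (enn2real (liminf (\<lambda>j. ennreal (real (Suc j) / 2) * A (1 / real (Suc j)) x \<omega>)) powr q) \<partial>lborel)" for \<omega>
  have A[measurable]: "(\<lambda>z. A r (snd z) (fst z)) \<in> borel_measurable (completion M \<Otimes>\<^sub>M borel)" for r
  proof -
    have [measurable]: "(\<lambda>p. limit_path (snd p) (fst (fst p))) \<in> borel_measurable ((completion M \<Otimes>\<^sub>M borel) \<Otimes>\<^sub>M lborel)"
      by (rule measurable_compose[OF _ measurable_limit_path, of "\<lambda>p. (snd p, fst (fst p))", simplified]) measurable
    show ?thesis unfolding A_def by measurable
  qed
  have [measurable]: "F \<in> borel_measurable (completion M)"
    unfolding F_def by measurable
  have "{\<omega>\<in>space (completion M). F \<omega> < ennreal \<epsilon>} \<in> sets (completion M)" by measurable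
  then have F: "{\<omega>\<in>space M. F \<omega> < ennreal \<epsilon>} \<in> sets (completion M)" by simp
  have "AE \<omega> in completion M. \<omega> \<in> {\<omega>\<in>space M. F \<omega> < ennreal \<epsilon>} \<longleftrightarrow>
     \<omega> \<in> {\<omega>\<in>space M. (\<integral>\<^sup>+x. ennreal (L x (exit_time B \<omega>) \<omega> powr q) \<partial>lborel) < ennreal \<epsilon>}"
    using AE_completion[OF AE_local_time_path[OF L]]
  proof eventually_elim
    case (elim \<omega>)
    interpret local_time_path "\<lambda>t. B t \<omega>" "\<lambda>x t. L x t \<omega>" by fact
    note e = exit_time_eq[OF elim]
    have A_eq: "A r x \<omega> = near_time r x exit" for r x
      unfolding A_def near_time_def e using limit_path_eq[OF cont]
      by (intro nn_integral_cong) (auto simp: indicator_def)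
    have "liminf (\<lambda>j. ennreal (real (Suc j) / 2) * A (1 / real (Suc j)) x \<omega>) = ennreal (L x exit \<omega>)" for x
      unfolding A_eq using near_time_tendsto[of exit x] exit_pos by (intro lim_imp_Liminf) auto
    then have "F \<omega> = (\<integral>\<^sup>+x. ennreal (L x (exit_time B \<omega>) \<omega> powr q) \<partial>lborel)"
      unfolding F_def e using l_nonneg[of exit] exit_pos by simp
    then show ?case by simp
  qed
  then show ?thesis
    by (rule complete_measure.in_sets_AE[OF complete_measure_completion _ F]) auto
qed

section \<open>Upper bound for the probability\<close>

text \<open>If the exit happens before \<open>t\<close>, then on all sufficiently fine grids the path exceeds 99/100, and each of
these grid events has the same bound. The restriction \<open>t \<le> 2\<close> ensures that the level 99/100 is at least
0.7 standard deviations at time \<open>t\<close>.\<close>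

lemma exit_time_less_prob:
  assumes L: "local_time_field M B L" and t: "0 < t" "t \<le> 2"
  shows "measure (completion M) {\<omega>\<in>space M. exit_time B \<omega> < t} \<le> exp (- ((99/100)\<^sup>2 / (450 * t)))"
proof -
  note measurable_B[measurable]
  let ?c = "exp (- ((99/100)\<^sup>2 / (450 * t)))"
  define G where "G n = {\<omega>\<in>space M. \<exists>k\<le>n. 99/100 \<le> \<bar>B (real k * (t / real n)) \<omega> - B 0 \<omega>\<bar>}" for n :: nat
  have Gm[measurable]: "G n \<in> sets M" for n
  proof -
    have [measurable]: "B (real k * (t / real n)) \<in> borel_measurable M" for k
      using t by (intro measurable_B) auto
    show ?thesis unfolding G_def by measurable
  qed
  have G: "prob (G n) \<le> ?c" if "1 \<le> n" for n
  proof -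
    define h where "h = t / real n"
    have h: "0 < h" and nh: "real n * h = t" using t that by (auto simp: h_def)
    have D: "distributed M lborel (\<lambda>\<omega>. B (real n * h) \<omega> - B (real 0 * h) \<omega>) (normal_density 0 (sqrt t))"
      using grid_normal_increments[OF h, of 0 n] that nh by simp
    have half: "1/2 \<le> prob {\<omega>\<in>space M. 0 \<le> B (real n * h) \<omega> - B (real k * h) \<omega>}
        \<and> 1/2 \<le> prob {\<omega>\<in>space M. B (real n * h) \<omega> - B (real k * h) \<omega> \<le> 0}" if "k \<le> n" for k
    proof (cases "k = n")
      case False
      then have "k < n" "0 < real (n - k) * h" using that h by auto
      then show ?thesis
        using gaussian_half[OF grid_normal_increments[OF h \<open>k < n\<close>]] by blast
    qed (simp add: prob_space)
    have "prob (G n) = prob {\<omega>\<in>space M. \<exists>k\<le>n. 99/100 \<le> \<bar>B (real k * h) \<omega> - B (real 0 * h) \<omega>\<bar>}"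
      by (simp add: G_def h_def)
    also have "\<dots> \<le> 2 * prob {\<omega>\<in>space M. 99/100 \<le> \<bar>B (real n * h) \<omega> - B (real 0 * h) \<omega>\<bar>}"
    proof (rule Levy_maximal_inequality)
      show "indep_vars (\<lambda>_. borel) (\<lambda>i \<omega>. B (real (Suc i) * h) \<omega> - B (real i * h) \<omega>) {..<n}"
        using h by (intro grid_indep_increments) simp
      show "B (real k * h) \<in> borel_measurable M" for k
        using h by (intro measurable_B) simp
    qed (use half in auto)
    also have "\<dots> \<le> ?c"
    proof -
      have "7/10 * sqrt t \<le> 99/100"
      proof -
        have "sqrt t \<le> sqrt 2" using t by simp
        also have "sqrt 2 \<le> 141422/100000" by (rule real_le_lsqrt) (auto simp: power2_eq_square)
        finally show ?thesis by simp
      qed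
      from twice_gaussian_tail[OF D t(1) this] show ?thesis .
    qed
    finally show ?thesis .
  qed
  define H where "H N = (\<Inter>n\<in>{Suc N..}. G n)" for N
  have Hm[measurable]: "H N \<in> sets M" for N unfolding H_def by measurable
  have "incseq H" unfolding H_def incseq_def by auto
  have "prob (H N) \<le> ?c" for N
    by (rule order_trans[OF finite_measure_mono G[of "Suc N"]]) (auto simp: H_def)
  moreover have "(\<lambda>N. prob (H N)) \<longlonglongrightarrow> prob (\<Union>N. H N)"
    using \<open>incseq H\<close> by (intro finite_Lim_measure_incseq) auto
  ultimately have U: "prob (\<Union>N. H N) \<le> ?c" by (intro LIMSEQ_le_const2) auto
  have "AE \<omega> in completion M. \<omega> \<in> {\<omega>\<in>space M. exit_time B \<omega> < t} \<longrightarrow> \<omega> \<in> (\<Union>N. H N)"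
    using AE_completion[OF AE_local_time_path[OF L]]
  proof eventually_elim
    case (elim \<omega>)
    interpret local_time_path "\<lambda>t. B t \<omega>" "\<lambda>x t. L x t \<omega>" by fact
    show ?case
    proof
      assume *: "\<omega> \<in> {\<omega>\<in>space M. exit_time B \<omega> < t}"
      then have "exit < t" by (simp add: exit_time_eq[OF elim])
      from exit_less_imp_grid_large[OF this] obtain N
        where "\<And>n. N \<le> n \<Longrightarrow> \<exists>k\<le>n. 99/100 \<le> \<bar>B (real k * (t / real n)) \<omega>\<bar>"
        unfolding eventually_sequentially by blast
      then have "\<omega> \<in> H N" using * start by (auto simp: H_def G_def)
      then show "\<omega> \<in> (\<Union>N. H N)" by blast
    qed
  qed
  then have "emeasure (completion M) {\<omega>\<in>space M. exit_time B \<omega> < t} \<le> emeasure (completion M) (\<Union>N. H N)"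
    by (rule emeasure_mono_AE) auto
  also have "\<dots> = ennreal (prob (\<Union>N. H N))" by (simp add: emeasure_eq_measure)
  finally have "measure (completion M) {\<omega>\<in>space M. exit_time B \<omega> < t} \<le> prob (\<Union>N. H N)"
    unfolding measure_def[of "completion M"] by (rule enn2real_leI[OF measure_nonneg])
  with U show ?thesis by simp
qed

lemma small_local_time_prob_le:
  assumes L: "local_time_field M B L" and q: "1 \<le> q" and \<epsilon>: "0 < \<epsilon>" "\<epsilon> < 1"
  shows "small_local_time_prob M B L q \<epsilon> \<le> exp (- ((99/100)\<^sup>2 / 900 * \<epsilon> powr (- (1 / q))))"
proof -
  interpret C: prob_space "completion M" by (rule prob_space_completion)
  note measurable_exit_time[OF L, measurable]
  let ?t = "2 * \<epsilon> powr (1 / q)"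
  have E: "{\<omega>\<in>space M. exit_time B \<omega> < ?t} \<in> sets (completion M)"
  proof -
    have "{\<omega>\<in>space (completion M). exit_time B \<omega> < ?t} \<in> sets (completion M)" by measurable
    then show ?thesis unfolding space_completion .
  qed
  have "\<epsilon> powr (1 / q) \<le> 1" using \<epsilon> q by (intro powr_le1) auto
  then have t: "0 < ?t" "?t \<le> 2" using \<epsilon> by auto
  have "small_local_time_prob M B L q \<epsilon> \<le> measure (completion M) {\<omega>\<in>space M. exit_time B \<omega> < ?t}"
    unfolding small_local_time_prob_def
  proof (rule C.finite_measure_mono_AE[OF _ E])
    show "AE \<omega> in completion M.
        \<omega> \<in> {\<omega>\<in>space M. (\<integral>\<^sup>+x. ennreal (L x (exit_time B \<omega>) \<omega> powr q) \<partial>lborel) < ennreal \<epsilon>} \<longrightarrow>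
        \<omega> \<in> {\<omega>\<in>space M. exit_time B \<omega> < ?t}"
      using AE_completion[OF AE_local_time_path[OF L]]
    proof eventually_elim
      case (elim \<omega>)
      then show ?case
        using local_time_path.exit_less_of_small_power_integral[OF elim q \<epsilon>(1)]
        by (simp add: exit_time_eq[OF elim])
    qed
  qed
  also have "\<dots> \<le> exp (- ((99/100)\<^sup>2 / (450 * ?t)))" by (rule exit_time_less_prob[OF L t])
  also have "(99/100)\<^sup>2 / (450 * ?t) = (99/100)\<^sup>2 / 900 * \<epsilon> powr (- (1 / q))"
    by (simp add: powr_minus_divide)
  finally show ?thesis .
qed

end

section \<open>Lower bound for the probability\<close>

text \<open>The constant \<open>C\<close> in the bound \<open>C / \<mu> ^ Suc p\<close> for the moment of order \<open>Suc p\<close>: a factor \<open>2 T = 4 / \<mu>\<close> for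
the first visit, and one bounded multiple of \<open>1 / \<mu>\<close> for each of the \<open>p\<close> returns, whose orderings
give the factorial.\<close>

definition moment_const :: "nat \<Rightarrow> real" where
  "moment_const p = 4 * fact (Suc p) * (1 + 12 * 2 ^ p) ^ p"

text \<open>The two smallness conditions make the discretization harmless: the window is so narrow that the
exponential factors stay below 3, and the time step so small that the visit at time 0 costs at
most \<open>1 / \<mu>\<close>.\<close>

lemma prod_return_bound_le:
  fixes \<mu> h r :: real
  assumes "0 < \<mu>" "0 < h" "0 < r" "\<mu> * (2 ^ p * r) \<le> 1" "h \<le> r / \<mu>"
  shows "(h / r) ^ p * (\<Prod>i<p. return_bound \<mu> h (2 ^ i * (2 * r))) \<le> ((1 + 12 * 2 ^ p) / \<mu>) ^ p"
proof -
  have "(h / r) ^ p * (\<Prod>i<p. return_bound \<mu> h (2 ^ i * (2 * r)))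
      = (\<Prod>i<p. h / r * return_bound \<mu> h (2 ^ i * (2 * r)))"
    unfolding prod.distrib by (simp only: prod_constant card_lessThan)
  also have "\<dots> \<le> (\<Prod>i<p. (1 + 12 * 2 ^ p) / \<mu>)"
  proof (intro prod_mono conjI)
    fix i assume "i \<in> {..<p}"
    then have "(2::real) ^ Suc i \<le> 2 ^ p" by (intro power_increasing) auto
    then have e: "2 ^ i * (2 * r) \<le> 2 ^ p * r" using assms by simp
    have "\<mu> * (2 ^ i * (2 * r)) \<le> \<mu> * (2 ^ p * r)" using e assms by (intro mult_left_mono) auto
    also have "\<dots> \<le> 1" by fact
    finally have "exp (\<mu> * (2 ^ i * (2 * r))) \<le> exp 1" by simp
    also have "\<dots> \<le> 3" by (rule exp_le)
    finally have ex: "exp (\<mu> * (2 ^ i * (2 * r))) \<le> 3" .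
    show "0 \<le> h / r * return_bound \<mu> h (2 ^ i * (2 * r))"
      using assms unfolding return_bound_def by (intro mult_nonneg_nonneg add_nonneg_nonneg) auto
    have "h / r * return_bound \<mu> h (2 ^ i * (2 * r))
      = h / r + 4 * (2 ^ i * (2 * r)) * exp (\<mu> * (2 ^ i * (2 * r))) / (\<mu> * r)"
      unfolding return_bound_def using assms by (simp add: field_simps)
    also have "\<dots> \<le> 1 / \<mu> + 4 * (2 ^ p * r) * 3 / (\<mu> * r)"
    proof (intro add_mono divide_right_mono mult_mono[OF mult_left_mono[OF e] ex])
      show "h / r \<le> 1 / \<mu>" using assms by (simp add: field_simps)
    qed (use assms in auto)
    also have "\<dots> = (1 + 12 * 2 ^ p) / \<mu>" using assms by (simp add: field_simps)
    finally show "h / r * return_bound \<mu> h (2 ^ i * (2 * r)) \<le> (1 + 12 * 2 ^ p) / \<mu>" .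
  qed
  also have "\<dots> = ((1 + 12 * 2 ^ p) / \<mu>) ^ p" by simp
  finally show ?thesis .
qed

context standard_brownian_motion
begin

text \<open>The Cameron-Martin density at time \<open>2 / \<mu>\<close>, where the drift \<open>\<mu>\<close> has carried the path to mean position 2.\<close>

definition tilt :: "real \<Rightarrow> 'a \<Rightarrow> real" where
  "tilt \<mu> \<omega> = exp (\<mu> * (B (2 / \<mu>) \<omega> - B 0 \<omega>) - \<mu>\<^sup>2 * (2 / \<mu>) / 2)"

definition grid_occupation :: "nat \<Rightarrow> real \<Rightarrow> real \<Rightarrow> nat \<Rightarrow> 'a \<Rightarrow> ennreal" where
  "grid_occupation m T r n \<omega> = (\<integral>\<^sup>+x. (ennreal (1 / r) * (ennreal (T / real n) *
       (\<Sum>k<n. indicator {y. \<bar>y\<bar> < r} (B (real k * (T / real n)) \<omega> - x)))) ^ m \<partial>lborel)"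

lemma measurable_tilt: "0 < \<mu> \<Longrightarrow> tilt \<mu> \<in> borel_measurable M"
proof -
  assume "0 < \<mu>"
  then have [measurable]: "B (2 / \<mu>) \<in> borel_measurable M" "B 0 \<in> borel_measurable M"
    by (auto intro: measurable_B)
  show ?thesis unfolding tilt_def by measurable
qed

lemma measurable_grid_occupation:
  assumes "0 < T"
  shows "grid_occupation m T r n \<in> borel_measurable M"
proof -
  have [measurable]: "B (real k * (T / real n)) \<in> borel_measurable M" for k
    using assms by (intro measurable_B) auto
  show ?thesis unfolding grid_occupation_def by measurable
qed

lemma grid_occupation_moment:
  assumes \<mu>: "0 < \<mu>" and r: "0 < r" "\<mu> * (2 ^ p * r) \<le> 1" and n: "0 < n" "2 / \<mu> / real n \<le> r / \<mu>"
  shows "(\<integral>\<^sup>+\<omega>. ennreal (tilt \<mu> \<omega>) * grid_occupation (Suc p) (2 / \<mu>) r n \<omega> \<partial>M) \<le> ennreal (moment_const p / \<mu> ^ Suc p)"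
proof -
  define h where "h = 2 / \<mu> / real n"
  have h: "0 < h" and nh: "real n * h = 2 / \<mu>" using \<mu> n by (auto simp: h_def)
  let ?S = "\<lambda>k. B (real k * h)"
  let ?J = "\<lambda>\<omega>. \<integral>\<^sup>+x. (\<Sum>i<n. indicator {y. \<bar>y\<bar> < r} (?S i \<omega> - x)) ^ Suc p \<partial>lborel"
  have [measurable]: "?S k \<in> borel_measurable M" for k
    using h by (intro measurable_B) auto
  have [measurable]: "tilt \<mu> \<in> borel_measurable M" by (rule measurable_tilt[OF \<mu>])
  have W: "drift_weight \<mu> h (\<lambda>k. ?S k \<omega>) 0 n = tilt \<mu> \<omega>" for \<omega>
    unfolding drift_weight_def tilt_def using nh by simp
  have P: "0 \<le> (\<Prod>i<p. return_bound \<mu> h (2 ^ i * (2 * r)))"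
    using \<mu> h r unfolding return_bound_def by (intro prod_nonneg add_nonneg_nonneg) auto
  have "grid_occupation (Suc p) (2 / \<mu>) r n \<omega> = ennreal ((h / r) ^ Suc p) * ?J \<omega>" for \<omega>
  proof -
    have "ennreal (1 / r) * (ennreal h * y) = ennreal (h / r) * y" for y
      using h r by (simp flip: mult.assoc ennreal_mult)
    then have "grid_occupation (Suc p) (2 / \<mu>) r n \<omega>
      = (\<integral>\<^sup>+x. ennreal (h / r) ^ Suc p * (\<Sum>i<n. indicator {y. \<bar>y\<bar> < r} (?S i \<omega> - x)) ^ Suc p \<partial>lborel)"
      unfolding grid_occupation_def h_def[symmetric] by (simp only: power_mult_distrib)
    also have "\<dots> = ennreal (h / r) ^ Suc p * ?J \<omega>"
      by (rule nn_integral_cmult) measurable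
    finally show ?thesis using ennreal_power[of "h / r" "Suc p"] h r by (simp del: power_Suc)
  qed
  then have "(\<integral>\<^sup>+\<omega>. ennreal (tilt \<mu> \<omega>) * grid_occupation (Suc p) (2 / \<mu>) r n \<omega> \<partial>M)
      = (\<integral>\<^sup>+\<omega>. ennreal ((h / r) ^ Suc p) * (ennreal (tilt \<mu> \<omega>) * ?J \<omega>) \<partial>M)"
    by (simp only: mult.left_commute)
  also have "\<dots> = ennreal ((h / r) ^ Suc p) * (\<integral>\<^sup>+\<omega>. ennreal (tilt \<mu> \<omega>) * ?J \<omega> \<partial>M)"
    by (rule nn_integral_cmult) measurable
  also have "\<dots> \<le> ennreal ((h / r) ^ Suc p) * ennreal (fact (Suc p) * (real n * (2 * r)) * (\<Prod>i<p. return_bound \<mu> h (2 ^ i * (2 * r))))"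
    unfolding W[symmetric]
  proof (rule mult_left_mono[OF drift_occupation_moment])
    show "indep_vars (\<lambda>_. borel) (\<lambda>i \<omega>. B (real (Suc i) * h) \<omega> - B (real i * h) \<omega>) {..<n}"
      using h by (intro grid_indep_increments) simp
    show "distributed M lborel (\<lambda>\<omega>. B (real l * h) \<omega> - B (real j * h) \<omega>) (\<lambda>x. ennreal (normal_density 0 (sqrt (real (l - j) * h)) x))"
      if "j < l" "l \<le> n" for j l
      using h that by (intro grid_normal_increments) auto
  qed (use h \<mu> r in auto)
  also have "\<dots> = ennreal ((h / r) ^ Suc p * (fact (Suc p) * (real n * (2 * r)) * (\<Prod>i<p. return_bound \<mu> h (2 ^ i * (2 * r)))))"
    using h r by (intro ennreal_mult''[symmetric] mult_nonneg_nonneg P) auto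
  also have "\<dots> \<le> ennreal (moment_const p / \<mu> ^ Suc p)"
  proof (rule ennreal_leI)
    have "(h / r) ^ Suc p * (fact (Suc p) * (real n * (2 * r)) * (\<Prod>i<p. return_bound \<mu> h (2 ^ i * (2 * r))))
      = fact (Suc p) * (2 * (real n * h)) * ((h / r) ^ p * (\<Prod>i<p. return_bound \<mu> h (2 ^ i * (2 * r))))"
      using r by simp
    also have "\<dots> \<le> fact (Suc p) * (2 * (real n * h)) * ((1 + 12 * 2 ^ p) / \<mu>) ^ p"
      using h \<mu> r n by (intro mult_left_mono prod_return_bound_le) (auto simp: h_def)
    also have "\<dots> = moment_const p / \<mu> ^ Suc p"
      unfolding nh moment_const_def by (simp add: power_divide)
    finally show "(h / r) ^ Suc p * (fact (Suc p) * (real n * (2 * r)) * (\<Prod>i<p. return_bound \<mu> h (2 ^ i * (2 * r)))) \<le> moment_const p / \<mu> ^ Suc p" .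
  qed
  finally show ?thesis .
qed

text \<open>A measurable upper bound for the integral of the \<open>m\<close>-th power of the local time at \<open>T\<close>, built from the
values of the path on time grids.\<close>

definition limit_occupation :: "nat \<Rightarrow> real \<Rightarrow> 'a \<Rightarrow> ennreal" where
  "limit_occupation m T \<omega> = liminf (\<lambda>j. liminf (\<lambda>n. grid_occupation m T (2 / real (Suc j)) n \<omega>))"

lemma measurable_limit_occupation:
  assumes "0 < T"
  shows "limit_occupation m T \<in> borel_measurable M"
proof -
  note measurable_grid_occupation[OF assms, measurable]
  show ?thesis unfolding limit_occupation_def by measurable
qed

text \<open>Fatou's lemma twice, for the measure with density \<open>tilt \<mu>\<close>. The order of the limits matters: the
grid count is controlled only when the time step is small compared with the window.\<close>

lemma limit_occupation_moment:
  assumes \<mu>: "0 < \<mu>"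
  shows "(\<integral>\<^sup>+\<omega>. ennreal (tilt \<mu> \<omega>) * limit_occupation (Suc p) (2 / \<mu>) \<omega> \<partial>M) \<le> ennreal (moment_const p / \<mu> ^ Suc p)"
proof -
  let ?c = "ennreal (moment_const p / \<mu> ^ Suc p)"
  let ?Q = "density M (\<lambda>\<omega>. ennreal (tilt \<mu> \<omega>))"
  let ?K = "\<lambda>j n. grid_occupation (Suc p) (2 / \<mu>) (2 / real (Suc j)) n"
  have T: "0 < 2 / \<mu>" using \<mu> by simp
  note measurable_tilt[OF \<mu>, measurable] measurable_grid_occupation[OF T, measurable] measurable_limit_occupation[OF T, measurable]
  have Q: "(\<integral>\<^sup>+\<omega>. f \<omega> \<partial>?Q) = (\<integral>\<^sup>+\<omega>. ennreal (tilt \<mu> \<omega>) * f \<omega> \<partial>M)"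
    if "f \<in> borel_measurable M" for f
    by (rule nn_integral_density) (use that in measurable)
  have n_lim: "liminf (\<lambda>n. \<integral>\<^sup>+\<omega>. ?K j n \<omega> \<partial>?Q) \<le> ?c" if j: "\<mu> * 2 ^ Suc p \<le> real (Suc j)" for j
  proof -
    let ?r = "2 / real (Suc j)"
    have r: "0 < ?r" "\<mu> * (2 ^ p * ?r) \<le> 1" using j by (simp_all add: field_simps)
    obtain N :: nat where N: "real (Suc j) < real N" using reals_Archimedean2 by blast
    have "(\<integral>\<^sup>+\<omega>. ?K j n \<omega> \<partial>?Q) \<le> ?c" if "N \<le> n" for n
    proof -
      have n: "0 < n" "real (Suc j) \<le> real n" using that N by auto
      have "2 / real n \<le> ?r" using n by (intro divide_left_mono) auto
      then have "2 / \<mu> / real n \<le> ?r / \<mu>" 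
        using divide_right_mono[of "2 / real n" ?r \<mu>] \<mu> by (simp add: mult.commute del: of_nat_Suc)
      then show ?thesis
        by (subst Q) (use measurable_grid_occupation[OF T] grid_occupation_moment[OF \<mu> r n(1)] in auto)
    qed
    then have "\<forall>\<^sub>F n in sequentially. (\<integral>\<^sup>+\<omega>. ?K j n \<omega> \<partial>?Q) \<le> ?c"
      unfolding eventually_sequentially by blast
    then have "liminf (\<lambda>n. \<integral>\<^sup>+\<omega>. ?K j n \<omega> \<partial>?Q) \<le> liminf (\<lambda>n::nat. ?c)" by (rule Liminf_mono)
    then show ?thesis by (simp add: Liminf_const)
  qed
  have "(\<integral>\<^sup>+\<omega>. ennreal (tilt \<mu> \<omega>) * limit_occupation (Suc p) (2 / \<mu>) \<omega> \<partial>M)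
     = (\<integral>\<^sup>+\<omega>. liminf (\<lambda>j. liminf (\<lambda>n. ?K j n \<omega>)) \<partial>?Q)"
    unfolding Q[OF measurable_limit_occupation[OF T], symmetric] unfolding limit_occupation_def ..
  also have "\<dots> \<le> liminf (\<lambda>j. \<integral>\<^sup>+\<omega>. liminf (\<lambda>n. ?K j n \<omega>) \<partial>?Q)"
    by (rule nn_integral_liminf) measurable
  also have "\<dots> \<le> liminf (\<lambda>j. liminf (\<lambda>n. \<integral>\<^sup>+\<omega>. ?K j n \<omega> \<partial>?Q))"
    by (intro Liminf_mono always_eventually allI nn_integral_liminf) measurable
  also have "\<dots> \<le> liminf (\<lambda>j::nat. ?c)"
  proof (rule Liminf_mono)
    obtain N :: nat where N: "\<mu> * 2 ^ Suc p < real N" using reals_Archimedean2 by blast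
    have "liminf (\<lambda>n. \<integral>\<^sup>+\<omega>. ?K j n \<omega> \<partial>?Q) \<le> ?c" if "N \<le> j" for j
      using N that by (intro n_lim) simp
    then show "\<forall>\<^sub>F j in sequentially. liminf (\<lambda>n. \<integral>\<^sup>+\<omega>. ?K j n \<omega> \<partial>?Q) \<le> ?c"
      unfolding eventually_sequentially by blast
  qed
  also have "\<dots> = ?c" by (simp add: Liminf_const)
  finally show ?thesis .
qed

text \<open>Under the drift the event fails with probability at most \<open>2 / \<mu> + 1/4 \<le> 3/4\<close>, by the inequalities of
Chebyshev and Markov. On the event the density is at most \<open>exp (2 \<mu>)\<close>, which bounds the undrifted
probability from below by \<open>exp (- 2 \<mu>) / 4\<close>.\<close>

lemma drifted_paths_prob:
  assumes \<mu>: "4 \<le> \<mu>"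
  shows "exp (- (4 * \<mu>)) \<le> prob {\<omega>\<in>space M. \<bar>B (2 / \<mu>) \<omega> - B 0 \<omega> - 2\<bar> < 1 \<and>
     limit_occupation (Suc p) (2 / \<mu>) \<omega> < ennreal (4 * (moment_const p / \<mu> ^ Suc p))}" (is "_ \<le> prob ?A")
proof -
  have \<mu>0: "0 < \<mu>" and T: "0 < 2 / \<mu>" using \<mu> by auto
  define c where "c = moment_const p / \<mu> ^ Suc p"
  have c: "0 < c" using \<mu>0 unfolding c_def moment_const_def by (intro divide_pos_pos mult_pos_pos zero_less_power) (auto intro: add_pos_pos)
  let ?D = "\<lambda>\<omega>. B (2 / \<mu>) \<omega> - B 0 \<omega>"
  let ?Z = "\<lambda>\<omega>. ennreal (tilt \<mu> \<omega>)"
  let ?I = "limit_occupation (Suc p) (2 / \<mu>)"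
  note measurable_tilt[OF \<mu>0, measurable] measurable_limit_occupation[OF T, measurable]
  have [measurable]: "B (2 / \<mu>) \<in> borel_measurable M" "B 0 \<in> borel_measurable M"
    using T by (auto intro: measurable_B)
  have A[measurable]: "?A \<in> sets M" by measurable
  have D: "distributed M lborel ?D (normal_density 0 (sqrt (2 / \<mu>)))"
    using normal_increments[of 0 "2 / \<mu>"] T by simp
  have tilt: "tilt \<mu> \<omega> = exp (\<mu> * ?D \<omega> - \<mu>\<^sup>2 * (2 / \<mu>) / 2)" for \<omega> by (simp add: tilt_def)
  have "1 = (\<integral>\<^sup>+\<omega>. ?Z \<omega> \<partial>M)"
    unfolding tilt using tilted_gaussian_mean[OF D T, of \<mu>] by simp
  also have "\<dots> \<le> (\<integral>\<^sup>+\<omega>. (?Z \<omega> * indicator ?A \<omega> + ?Z \<omega> * indicator {x. 1 \<le> \<bar>x - 2\<bar>} (?D \<omega>))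
       + ennreal (1 / (4 * c)) * (?Z \<omega> * ?I \<omega>) \<partial>M)"
  proof (intro nn_integral_mono)
    fix \<omega> assume \<omega>: "\<omega> \<in> space M"
    consider "\<omega> \<in> ?A" | "1 \<le> \<bar>?D \<omega> - 2\<bar>" | "ennreal (4 * c) \<le> ?I \<omega>"
      using \<omega> unfolding c_def by fastforce
    then show "?Z \<omega> \<le> (?Z \<omega> * indicator ?A \<omega> + ?Z \<omega> * indicator {x. 1 \<le> \<bar>x - 2\<bar>} (?D \<omega>))
       + ennreal (1 / (4 * c)) * (?Z \<omega> * ?I \<omega>)"
    proof cases
      case 1
      then show ?thesis by (simp add: add.assoc)
    next
      case 2
      then have "?Z \<omega> \<le> ?Z \<omega> * indicator {x. 1 \<le> \<bar>x - 2\<bar>} (?D \<omega>)" by simp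
      then show ?thesis by (meson add_increasing add_increasing2 zero_le)
    next
      case 3
      have "?Z \<omega> = ennreal (1 / (4 * c)) * (?Z \<omega> * ennreal (4 * c))"
        using c by (simp add: tilt_def flip: ennreal_mult'')
      also have "\<dots> \<le> ennreal (1 / (4 * c)) * (?Z \<omega> * ?I \<omega>)"
        using 3 by (intro mult_left_mono) auto
      finally show ?thesis by (meson add_increasing zero_le)
    qed
  qed
  also have "\<dots> = ((\<integral>\<^sup>+\<omega>. ?Z \<omega> * indicator ?A \<omega> \<partial>M) + (\<integral>\<^sup>+\<omega>. ?Z \<omega> * indicator {x. 1 \<le> \<bar>x - 2\<bar>} (?D \<omega>) \<partial>M))
       + ennreal (1 / (4 * c)) * (\<integral>\<^sup>+\<omega>. ?Z \<omega> * ?I \<omega> \<partial>M)"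
    by (simp add: nn_integral_add nn_integral_cmult)
  also have "\<dots> \<le> (ennreal (exp (2 * \<mu>)) * ennreal (prob ?A) + ennreal (2 / \<mu>)) + ennreal (1 / (4 * c)) * ennreal c"
  proof (intro add_mono mult_left_mono)
    have "(\<integral>\<^sup>+\<omega>. ?Z \<omega> * indicator ?A \<omega> \<partial>M) \<le> (\<integral>\<^sup>+\<omega>. ennreal (exp (2 * \<mu>)) * indicator ?A \<omega> \<partial>M)"
    proof (intro nn_integral_mono)
      fix \<omega>
      have "tilt \<mu> \<omega> \<le> exp (2 * \<mu>)" if "\<omega> \<in> ?A"
      proof -
        have "?D \<omega> \<le> 3" using that by auto
        then have "\<mu> * ?D \<omega> \<le> \<mu> * 3" using \<mu>0 by (intro mult_left_mono) auto
        moreover have "\<mu>\<^sup>2 * (2 / \<mu>) / 2 = \<mu>" using \<mu>0 by (simp add: power2_eq_square)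
        ultimately show ?thesis unfolding tilt by simp
      qed
      then show "?Z \<omega> * indicator ?A \<omega> \<le> ennreal (exp (2 * \<mu>)) * indicator ?A \<omega>"
        by (auto simp: indicator_def intro: ennreal_leI)
    qed
    also have "\<dots> = ennreal (exp (2 * \<mu>)) * ennreal (prob ?A)"
      by (subst nn_integral_cmult_indicator[OF A]) (simp add: emeasure_eq_measure)
    finally show "(\<integral>\<^sup>+\<omega>. ?Z \<omega> * indicator ?A \<omega> \<partial>M) \<le> ennreal (exp (2 * \<mu>)) * ennreal (prob ?A)" .
    show "(\<integral>\<^sup>+\<omega>. ?Z \<omega> * indicator {x. 1 \<le> \<bar>x - 2\<bar>} (?D \<omega>) \<partial>M) \<le> ennreal (2 / \<mu>)"
      unfolding tilt using tilted_gaussian_deviation[OF D T, of \<mu>] \<mu>0 by simp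
    show "(\<integral>\<^sup>+\<omega>. ?Z \<omega> * ?I \<omega> \<partial>M) \<le> ennreal c"
      unfolding c_def by (rule limit_occupation_moment[OF \<mu>0])
  qed auto
  also have "\<dots> = ennreal (exp (2 * \<mu>) * prob ?A + 2 / \<mu> + 1 / 4)"
  proof -
    have "ennreal (1 / (4 * c)) * ennreal c = ennreal (1 / 4)" using c by (simp flip: ennreal_mult'')
    then show ?thesis using T by (simp add: ennreal_plus ennreal_mult' del: ennreal_eq_0_iff)
  qed
  finally have "1 \<le> exp (2 * \<mu>) * prob ?A + 2 / \<mu> + 1 / 4"
    using T by (subst (asm) ennreal_1[symmetric], subst (asm) ennreal_le_iff) (auto intro!: add_nonneg_nonneg)
  moreover have "2 / \<mu> \<le> 1 / 2" using \<mu> by (simp add: field_simps)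
  ultimately have main: "1 / 4 \<le> exp (2 * \<mu>) * prob ?A" by linarith
  have "4 \<le> exp (2 * \<mu>)" using exp_ge_add_one_self[of "2 * \<mu>"] \<mu> by linarith
  then have "exp (- (2 * \<mu>)) \<le> 1 / 4" by (simp add: exp_minus field_simps)
  with main have "exp (- (2 * \<mu>)) \<le> exp (2 * \<mu>) * prob ?A" by linarith
  then have "exp (- (2 * \<mu>)) * exp (- (2 * \<mu>)) \<le> exp (- (2 * \<mu>)) * (exp (2 * \<mu>) * prob ?A)"
    by (rule mult_left_mono) simp
  moreover have "exp (- (2 * \<mu>)) * exp (- (2 * \<mu>)) = exp (- (4 * \<mu>))" by (simp add: mult_exp_exp)
  moreover have "exp (- (2 * \<mu>)) * (exp (2 * \<mu>) * prob ?A) = prob ?A"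
    unfolding mult.assoc[symmetric] mult_exp_exp by simp
  ultimately show ?thesis by (simp only:)
qed

text \<open>The drift \<open>\<mu> = (D / \<epsilon>) powr (1/q)\<close> is chosen such that the power integral, of order \<open>\<mu> powr (-q)\<close>, falls
below \<open>\<epsilon>\<close>. The first condition on \<open>D\<close> makes \<open>\<mu> \<ge> 4\<close> for all \<open>\<epsilon> < 1\<close>; the second beats the constant
\<open>2 + 4 C\<close> that interpolation and Markov's inequality produce.\<close>

lemma small_local_time_prob_ge:
  assumes L: "local_time_field M B L" and q: "1 \<le> q" "q \<le> real (Suc p)" and \<epsilon>: "0 < \<epsilon>" "\<epsilon> < 1"
    and D: "4 powr q \<le> D" "3 + 4 * moment_const p \<le> D"
  shows "exp (- (4 * D powr (1 / q) * \<epsilon> powr (- (1 / q)))) \<le> small_local_time_prob M B L q \<epsilon>"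
proof -
  interpret C: prob_space "completion M" by (rule prob_space_completion)
  define \<mu> where "\<mu> = (D / \<epsilon>) powr (1 / q)"
  have D0: "0 < D" using D(1) powr_gt_zero[of 4 q] by linarith
  have "D \<le> D / \<epsilon>" using \<epsilon> D0 by (simp add: field_simps)
  then have "4 powr q \<le> D / \<epsilon>" using D by linarith
  then have "(4 powr q) powr (1 / q) \<le> \<mu>" unfolding \<mu>_def using q by (intro powr_mono2) auto
  then have \<mu>: "4 \<le> \<mu>" using q by (simp add: powr_powr)
  then have \<mu>0: "0 < \<mu>" and T: "0 < 2 / \<mu>" by auto
  have \<mu>q: "\<mu> powr - q = \<epsilon> / D"
    using \<epsilon> D0 q by (simp add: \<mu>_def powr_powr powr_minus)
  have \<mu>_eq: "\<mu> = D powr (1 / q) * \<epsilon> powr (- (1 / q))"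
    using \<epsilon> D0 by (simp add: \<mu>_def powr_divide powr_minus_divide)
  let ?A = "{\<omega>\<in>space M. \<bar>B (2 / \<mu>) \<omega> - B 0 \<omega> - 2\<bar> < 1 \<and>
     limit_occupation (Suc p) (2 / \<mu>) \<omega> < ennreal (4 * (moment_const p / \<mu> ^ Suc p))}"
  have A: "?A \<in> sets M"
  proof -
    note measurable_limit_occupation[OF T, measurable]
    have [measurable]: "B (2 / \<mu>) \<in> borel_measurable M" "B 0 \<in> borel_measurable M"
      using T by (auto intro: measurable_B)
    show ?thesis by measurable
  qed
  have C0: "0 \<le> moment_const p" unfolding moment_const_def by simp
  have "exp (- (4 * D powr (1 / q) * \<epsilon> powr (- (1 / q)))) \<le> prob ?A"
    using drifted_paths_prob[OF \<mu>, of p] by (simp add: \<mu>_eq mult.assoc)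
  also have "\<dots> = measure (completion M) ?A" using A by simp
  also have "\<dots> \<le> small_local_time_prob M B L q \<epsilon>"
    unfolding small_local_time_prob_def
  proof (rule C.finite_measure_mono_AE[OF _ measurable_small_local_time_event[OF L]])
    show "AE \<omega> in completion M. \<omega> \<in> ?A \<longrightarrow>
       \<omega> \<in> {\<omega>\<in>space M. (\<integral>\<^sup>+x. ennreal (L x (exit_time B \<omega>) \<omega> powr q) \<partial>lborel) < ennreal \<epsilon>}"
      using AE_completion[OF AE_local_time_path[OF L]]
    proof eventually_elim
      case (elim \<omega>)
      interpret local_time_path "\<lambda>t. B t \<omega>" "\<lambda>x t. L x t \<omega>" by fact
      show ?case
      proof
        assume \<omega>: "\<omega> \<in> ?A"
        then have "1 \<le> \<bar>B (2 / \<mu>) \<omega>\<bar>" using start by auto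
        then have exT: "exit \<le> 2 / \<mu>" using T by (intro exit_le) auto
        have rr: "1 / (2 / real (Suc j)) = real (Suc j) / 2" "2 * (1 / real (Suc j)) = 2 / real (Suc j)" for j by auto
        have "(\<integral>\<^sup>+x. ennreal (L x (2 / \<mu>) \<omega>) ^ Suc p \<partial>lborel) \<le> limit_occupation (Suc p) (2 / \<mu>) \<omega>"
          using power_integral_le_liminf_grid[OF T, of "Suc p"]
          unfolding limit_occupation_def grid_occupation_def rr .
        also have "\<dots> \<le> ennreal (4 * (moment_const p / \<mu> ^ Suc p))" using \<omega> by auto
        finally have I: "(\<integral>\<^sup>+x. ennreal (L x (2 / \<mu>) \<omega>) ^ Suc p \<partial>lborel) \<le> ennreal (4 * (moment_const p / \<mu> ^ Suc p))" .
        let ?a = "1 / \<mu>"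
        have "(\<integral>\<^sup>+x. ennreal (L x exit \<omega> powr q) \<partial>lborel)
          \<le> ennreal (?a powr (q - 1) * (2 / \<mu>)) + ennreal (?a powr (q - real (Suc p))) * (\<integral>\<^sup>+x. ennreal (L x (2 / \<mu>) \<omega>) ^ Suc p \<partial>lborel)"
          using \<mu>0 by (intro power_integral_exit_le q exT) auto
        also have "\<dots> \<le> ennreal (?a powr (q - 1) * (2 / \<mu>)) + ennreal (?a powr (q - real (Suc p))) * ennreal (4 * (moment_const p / \<mu> ^ Suc p))"
          by (intro add_left_mono mult_left_mono I) auto
        also have "\<dots> = ennreal (?a powr (q - 1) * (2 / \<mu>) + ?a powr (q - real (Suc p)) * (4 * (moment_const p / \<mu> ^ Suc p)))"
          using \<mu>0 C0 by (simp only: ennreal_mult'[symmetric] powr_ge_zero) (intro ennreal_plus[symmetric] mult_nonneg_nonneg divide_nonneg_nonneg, auto)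
        also have "?a powr (q - 1) * (2 / \<mu>) + ?a powr (q - real (Suc p)) * (4 * (moment_const p / \<mu> ^ Suc p))
           = (2 + 4 * moment_const p) * \<mu> powr - q"
        proof -
          have a: "?a powr x = \<mu> powr - x" for x using \<mu>0 by (simp add: powr_divide powr_minus_divide)
          have "?a powr (q - 1) * (2 / \<mu>) = 2 * (\<mu> powr (1 - q) * \<mu> powr - 1)"
            using \<mu>0 by (simp add: a powr_minus_divide)
          also have "\<dots> = 2 * \<mu> powr - q" by (simp only: powr_add[symmetric]) simp
          finally have 1: "?a powr (q - 1) * (2 / \<mu>) = 2 * \<mu> powr - q" .
          have "1 / \<mu> ^ Suc p = \<mu> powr - real (Suc p)"
            using \<mu>0 by (simp add: powr_minus_divide powr_realpow del: power_Suc of_nat_Suc)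
          then have "?a powr (q - real (Suc p)) * (4 * (moment_const p / \<mu> ^ Suc p))
             = 4 * moment_const p * (\<mu> powr (real (Suc p) - q) * \<mu> powr - real (Suc p))"
            unfolding a by (simp add: divide_inverse mult_ac del: power_Suc of_nat_Suc)
          also have "\<dots> = 4 * moment_const p * \<mu> powr - q" by (simp only: powr_add[symmetric]) simp
          finally show ?thesis unfolding 1 by (simp add: algebra_simps)
        qed
        also have "ennreal ((2 + 4 * moment_const p) * \<mu> powr - q) < ennreal \<epsilon>"
        proof (rule ennreal_lessI[OF \<epsilon>(1)])
          have "(2 + 4 * moment_const p) * \<epsilon> < D * \<epsilon>" using D(2) \<epsilon> by (intro mult_strict_right_mono) auto
          then show "(2 + 4 * moment_const p) * \<mu> powr - q < \<epsilon>"
            unfolding \<mu>q using D0 by (simp add: field_simps)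
        qed
        finally show "\<omega> \<in> {\<omega>\<in>space M. (\<integral>\<^sup>+x. ennreal (L x (exit_time B \<omega>) \<omega> powr q) \<partial>lborel) < ennreal \<epsilon>}"
          using \<omega> by (simp add: exit_time_eq[OF elim])
      qed
    qed
  qed
  finally show ?thesis .
qed

end

section \<open>The small deviation estimate\<close>

theorem theorem3:
  fixes M :: "'a measure"
    and B :: "real \<Rightarrow> 'a \<Rightarrow> real"
    and L :: "real \<Rightarrow> real \<Rightarrow> 'a \<Rightarrow> real"
    and q :: real
  assumes "standard_brownian_motion M B"
    and "local_time_field M B L"
    and "1 \<le> q"
  shows "comparable_on_unit (\<lambda>\<epsilon>. - ln (small_local_time_prob M B L q \<epsilon>))
           (\<lambda>\<epsilon>. \<epsilon> powr (- (1 / q)))"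
proof -
  interpret standard_brownian_motion M B by fact
  define p where "p = nat \<lceil>q\<rceil> - 1"
  have p: "q \<le> real (Suc p)" using \<open>1 \<le> q\<close> unfolding p_def by linarith
  define D where "D = max (4 powr q) (3 + 4 * moment_const p)"
  define K where "K = 4 * D powr (1 / q)"
  define k :: real where "k = (99/100)\<^sup>2 / 900"
  have "0 < D" unfolding D_def by (simp add: less_max_iff_disj)
  then have K: "0 < K" by (simp add: K_def)
  have k: "0 < k" by (simp add: k_def)
  have bounds: "k * \<epsilon> powr (- (1 / q)) \<le> - ln (small_local_time_prob M B L q \<epsilon>)
      \<and> - ln (small_local_time_prob M B L q \<epsilon>) \<le> K * \<epsilon> powr (- (1 / q))" if \<epsilon>: "0 < \<epsilon>" "\<epsilon> < 1" for \<epsilon>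
  proof -
    let ?P = "small_local_time_prob M B L q \<epsilon>"
    have up: "?P \<le> exp (- (k * \<epsilon> powr (- (1 / q))))"
      unfolding k_def by (rule small_local_time_prob_le[OF assms(2,3) \<epsilon>])
    have lo: "exp (- (K * \<epsilon> powr (- (1 / q)))) \<le> ?P"
      unfolding K_def by (rule small_local_time_prob_ge[OF assms(2,3) p \<epsilon>]) (auto simp: D_def)
    then have P: "0 < ?P" by (rule less_le_trans[OF exp_gt_zero])
    have "ln ?P \<le> ln (exp (- (k * \<epsilon> powr (- (1 / q)))))" using up P by (subst ln_le_cancel_iff) auto
    then have "ln ?P \<le> - (k * \<epsilon> powr (- (1 / q)))" by simp
    moreover have "- (K * \<epsilon> powr (- (1 / q))) \<le> ln ?P" using lo P by (simp add: ln_ge_iff)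
    ultimately show ?thesis by linarith
  qed
  show ?thesis
    unfolding comparable_on_unit_def
  proof (intro exI conjI allI impI)
    show "0 < 1 / K" using K by simp
    show "1 / K < 1 / k + 1 / K" using k by simp
    fix \<epsilon> :: real assume \<epsilon>: "0 < \<epsilon> \<and> \<epsilon> < 1"
    let ?P = "- ln (small_local_time_prob M B L q \<epsilon>)" and ?e = "\<epsilon> powr (- (1 / q))"
    have b: "k * ?e \<le> ?P" "?P \<le> K * ?e" using bounds \<epsilon> by auto
    show "1 / K * ?P \<le> ?e" using b(2) K by (simp add: field_simps)
    have "0 \<le> ?P" by (rule order_trans[OF _ b(1)]) (use k in auto)
    have "?e \<le> 1 / k * ?P" using b(1) k by (simp add: field_simps)
    also have "\<dots> \<le> (1 / k + 1 / K) * ?P" using \<open>0 \<le> ?P\<close> K by (intro mult_right_mono) auto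
    finally show "?e \<le> (1 / k + 1 / K) * ?P" .
  qed
qed

end
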